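(* Let $T$ be a rational pinwheel tiling with associated planar graph $RP$. Then the chromatic index of $RP$ is $\chi'(RP)=8$.
   Context: Rational pinwheel substitution. The prototile $K$ is the right triangle with side lengths $1,2,\sqrt5$. The substitution $\omega$ expands a tile by $\sqrt5$ and dissects it into five tiles: the expanded tile, placed as the triangle with vertices $(0,0)$ (right angle), $(2,-1)$, $(2,4)$, is dissected into the triangles with vertices $\{(2,-1),(2,0),(0,0)\}$, $\{(0,0),(1,0),(1,2)\}$, $\{(1,0),(2,0),(2,2)\}$, $\{(1,0),(1,2),(2,2)\}$, $\{(1,2),(2,2),(2,4)\}$. The rule is extended to all congruent copies of $K$ (including reflections) and to collections of tiles covariantly. A rational pinwheel tiling is a tiling $T$ of $\mathbb{R}^2$ by congruent copies of $K$ such that every finite set of tiles of $T$ is contained in a congruent copy of $\omega^n(K)$ for some $n\ge0$. Graph: the vertices are all points that are a corner of at least one tile; the edges are the segments, contained in tile boundaries, joining consecutive vertices (so a tile side containing vertices in its interior is subdivided by them). The chromatic index is the least number of colours in a proper edge colouring (edges sharing an endpoint get different colours). *)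

theory Defs
  imports "HOL-Analysis.Analysis"
begin

text \<open>The plane is \<^typ>\<open>real \<times> real\<close>, whose product metric is the Euclidean one. Tiles are closed
  triangular regions, i.e. point sets.\<close>

type_synonym plane = "real \<times> real"
type_synonym tile = "plane set"

text \<open>Distance-preserving self-maps of the plane; these include reflections.\<close>

definition isometry :: "(plane \<Rightarrow> plane) \<Rightarrow> bool" where
  "isometry f \<longleftrightarrow> (\<forall>x y. dist (f x) (f y) = dist x y)"

definition prototile :: tile where
  "prototile = convex hull {(0,0), (1,0), (0,2)}"

definition expanded_tile :: tile where
  "expanded_tile = convex hull {(0,0), (2,-1), (2,4)}"

definition dissection :: "tile set" where
  "dissection =
    {convex hull {(2,-1), (2,0), (0,0)},
     convex hull {(0,0), (1,0), (1,2)},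
     convex hull {(1,0), (2,0), (2,2)},
     convex hull {(1,0), (1,2), (2,2)},
     convex hull {(1,2), (2,2), (2,4)}}"

text \<open>The dissection of \<open>\<surd>5 t\<close> is the one of \<^const>\<open>expanded_tile\<close>, transported by the isometry
  carrying \<^const>\<open>expanded_tile\<close> to \<open>\<surd>5 t\<close>. There is exactly one such isometry when \<open>t\<close> is
  congruent to \<^const>\<open>prototile\<close>, since the triangle is scalene.\<close>

definition subst_tile :: "tile \<Rightarrow> tile set" where
  "subst_tile t =
    {f ` s | f s. isometry f \<and> f ` expanded_tile = (\<lambda>x. sqrt 5 *\<^sub>R x) ` t \<and> s \<in> dissection}"

definition pinwheel_subst :: "tile set \<Rightarrow> tile set" where
  "pinwheel_subst P = (\<Union>t\<in>P. subst_tile t)"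

definition supertile :: "nat \<Rightarrow> tile set" where
  "supertile n = (pinwheel_subst ^^ n) {prototile}"

definition tiling_by_prototile :: "tile set \<Rightarrow> bool" where
  "tiling_by_prototile T \<longleftrightarrow>
    (\<forall>t\<in>T. \<exists>f. isometry f \<and> t = f ` prototile) \<and>
    \<Union>T = UNIV \<and>
    pairwise (\<lambda>s t. interior s \<inter> interior t = {}) T"

definition rational_pinwheel_tiling :: "tile set \<Rightarrow> bool" where
  "rational_pinwheel_tiling T \<longleftrightarrow>
    tiling_by_prototile T \<and>
    (\<forall>P. finite P \<and> P \<subseteq> T \<longrightarrow>
      (\<exists>n f. isometry f \<and> P \<subseteq> (\<lambda>t. f ` t) ` supertile n))"

text \<open>A simple graph is a pair of a vertex set and a set of two-element edges.\<close>

type_synonym 'a graph = "'a set \<times> 'a set set"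

definition corner_points :: "tile set \<Rightarrow> plane set" where
  "corner_points T = {v. \<exists>t\<in>T. v extreme_point_of t}"

text \<open>An edge is recorded by its two end points, which determine the segment. A straight segment in
  the frontier of a triangle lies on one of its sides.\<close>

definition corner_edges :: "tile set \<Rightarrow> plane set set" where
  "corner_edges T =
    {{p, q} | p q. p \<in> corner_points T \<and> q \<in> corner_points T \<and> p \<noteq> q \<and>
      (\<exists>t\<in>T. closed_segment p q \<subseteq> frontier t) \<and>
      open_segment p q \<inter> corner_points T = {}}"

definition tiling_graph :: "tile set \<Rightarrow> plane graph" where
  "tiling_graph T = (corner_points T, corner_edges T)"

definition proper_edge_colouring :: "'a graph \<Rightarrow> ('a set \<Rightarrow> nat) \<Rightarrow> bool" where
  "proper_edge_colouring G c \<longleftrightarrow>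
    (\<forall>e\<in>snd G. \<forall>e'\<in>snd G. e \<noteq> e' \<and> e \<inter> e' \<noteq> {} \<longrightarrow> c e \<noteq> c e')"

text \<open>The value is \<open>\<infinity>\<close> if no finite number of colours suffices.\<close>

definition chromatic_index :: "'a graph \<Rightarrow> enat" where
  "chromatic_index G =
    Inf {enat k | k. \<exists>c. proper_edge_colouring G c \<and> c ` snd G \<subseteq> {..<k}}"

end

theory Submission
  imports Defs
begin

text \<open>
  Regard a tile as a quadrilateral with an additional flat corner at the midpoint of its leg of
  length \<open>2\<close>. With these corners a supertile is an edge-to-edge cell complex, because the
  subdivision \<open>1 + 2 + 2\<close> of a hypotenuse becomes \<open>1 + 1 + 1 + 1 + 1\<close>, which is symmetric.

  Deform the angles \<open>arctan (1/2)\<close>, \<open>arctan 2\<close>, \<open>\<pi>/2\<close> to \<open>\<pi>/4\<close>, \<open>\<pi>/4\<close>, \<open>\<pi>/2\<close>. This is consistent around every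
  node, so each edge gets a direction in \<open>\<int>/8\<close>, and edges at a common node get different directions.
  The edges have length \<open>1\<close> or \<open>\<surd>5\<close>, so as elements of \<open>\<int>[\<i>, 1/5]\<close> they are odd, that is nonzero modulo
  \<open>1 + \<i>\<close>. Hence the complex is bipartite, and the direction seen from the even end is a proper edge colouring with eight colours.
  An edge of the tiling graph is an edge of the complex or a full leg of length \<open>2\<close>. The latter only
  occurs between the two tiles that form a parallelogram in a dissection; one end of it has degree \<open>4\<close>
  with the direction opposite to it unused, so it may take the colour required at the other end.
  Finite patches of a tiling lie in supertiles, and compactness gives the upper bound.

  Conversely every node interior to a supertile has degree \<open>8\<close> after two further substitutions, and
  every tiling contains a large supertile.
\<close>

section \<open>Encoding of tiles and of the dissection\<close>

text \<open>Parities are never computed. Reversing an edge changes its direction by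
  \<open>4\<close>, and so does passing to a node of the other parity, so both darts of an edge
  carry one number; the \<open>2 + 4 + 1 + 1\<close> octants of a tile then meet every residue
  modulo \<open>8\<close> once. The values of \<open>shift\<close> are forced: the hypotenuses of
  children \<open>0\<close>, \<open>1\<close>, \<open>4\<close> lie on parent edges with colours
  \<open>0\<close>, \<open>2\<close>, \<open>6\<close>, and a reflected child sees the negative of
  the parent colour, which gives \<open>1\<close>, \<open>7\<close>, \<open>3\<close>; the long leg
  shared by children \<open>1\<close> and \<open>3\<close> and the hypotenuse shared by
  \<open>2\<close> and \<open>3\<close> give the rest.

  The obstacle is that neighbouring tiles may have a common ancestor only many levels up. The
  induction therefore carries a relation between two tiles and never asks where their parents lie:
  children of distinct parents can touch only at an old node, in a parent edge that survives as one
  child hypotenuse, or in a parent hypotenuse cut into five. The last case is harmless because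
  distinct parents run through a common hypotenuse in opposite directions, which fits the symmetric
  colour pattern \<open>1, 5, 1, 5, 1\<close>.\<close>

definition tri :: "plane set" where
  "tri = {z. 0 \<le> fst z \<and> 0 \<le> snd z \<and> 2 * fst z + snd z \<le> 2}"

definition tri_interior :: "plane set" where
  "tri_interior = {z. 0 < fst z \<and> 0 < snd z \<and> 2 * fst z + snd z < 2}"

definition etri :: "plane set" where
  "etri = {z. fst z \<le> 2 \<and> 0 \<le> fst z + 2 * snd z \<and> snd z \<le> 2 * fst z}"

definition etri_interior :: "plane set" where
  "etri_interior = {z. fst z < 2 \<and> 0 < fst z + 2 * snd z \<and> snd z < 2 * fst z}"

text \<open>In complex notation \<open>turn\<close> is multiplication by \<open>2 - \<i>\<close>, which carries the prototile to the
  expanded tile; points of the expanded tile are given in the integer coordinates of the dissection.\<close>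

definition emb :: "int \<times> int \<Rightarrow> plane" where
  "emb u = (of_int (fst u), of_int (snd u))"

definition turn :: "'a::comm_ring_1 \<times> 'a \<Rightarrow> 'a \<times> 'a" where
  "turn u = (2 * fst u + snd u, 2 * snd u - fst u)"

definition unturn :: "plane \<Rightarrow> plane" where
  "unturn z = ((2 * fst z - snd z) / 5, (fst z + 2 * snd z) / 5)"

definition place :: "nat \<Rightarrow> 'a::comm_ring_1 \<times> 'a \<Rightarrow> 'a \<times> 'a" where
  "place i u =
    (if i = 0 then (2 - snd u, - fst u)
     else if i = 1 then (1 - fst u, snd u)
     else if i = 2 then (2 - fst u, snd u)
     else if i = 3 then (1 + fst u, 2 - snd u)
     else (2 - fst u, 2 + snd u))"

text \<open>The colour of a tile is the deformed direction of its leg of length \<open>1\<close>, with \<open>4\<close> added if the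
  right-angled corner is an odd node; \<open>shift\<close> records its change under substitution. All tiles of a
  supertile have the same chirality, which changes with each substitution. Directions are measured
  in the orientation of the tiles, whence the sign in \<open>child\<close>.\<close>

definition shift :: "nat \<Rightarrow> int" where
  "shift i = (if i = 0 then 1 else if i = 1 then 7 else 3)"

definition nodes :: "(int \<times> int) set" where
  "nodes = {(0,0), (1,0), (0,1), (0,2)}"

text \<open>A dart is a directed edge of the quadrilateral together with its colour relative to the colour of the tile.\<close>

definition darts :: "((int \<times> int) \<times> (int \<times> int) \<times> int) set" where
  "darts = {((0,0),(1,0),0), ((1,0),(0,0),0), ((0,0),(0,1),2), ((0,1),(0,0),2),
            ((0,1),(0,2),6), ((0,2),(0,1),6), ((1,0),(0,2),7), ((0,2),(1,0),7)}"

text \<open>The deformed angle of the tile at a node consists of octants, numbered by the colour of the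
  edge at which they start. Disjointness of octants is what keeps the colours at a node distinct.\<close>

definition octants :: "((int \<times> int) \<times> int) set" where
  "octants = {((0,0),0), ((0,0),1), ((0,1),2), ((0,1),3), ((0,1),4), ((0,1),5), ((0,2),6), ((1,0),7)}"

type_synonym ltile = "(plane \<Rightarrow> plane) \<times> int"

definition child :: "nat \<Rightarrow> ltile \<Rightarrow> ltile" where
  "child i s = (fst s \<circ> unturn \<circ> place i, shift i - snd s)"

text \<open>Level \<open>n\<close> dissects the prototile itself into tiles shrunk by \<open>\<surd>5 ^ n\<close>, which keeps all coordinates rational.\<close>

primrec level :: "nat \<Rightarrow> ltile set" where
  "level 0 = {(id, 0)}"
| "level (Suc n) = {child i s | i s. i < 5 \<and> s \<in> level n}"

lemma lt5: "i < 5 \<longleftrightarrow> i = 0 \<or> i = 1 \<or> i = 2 \<or> i = 3 \<or> i = (4::nat)"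
  by auto

lemma all_less5: "(\<forall>i<5. P i) \<longleftrightarrow> P 0 \<and> P 1 \<and> P 2 \<and> P 3 \<and> P (4::nat)"
  unfolding lt5 by blast

lemma ex_less5: "(\<exists>i<5. P i) \<longleftrightarrow> P 0 \<or> P 1 \<or> P 2 \<or> P 3 \<or> P (4::nat)"
  unfolding lt5 by blast

lemma emb_eq_iff [simp]: "emb u = emb v \<longleftrightarrow> u = v"
  by (auto simp: emb_def prod_eq_iff)

lemma emb_place: "emb (place i u) = place i (emb u)"
  by (simp add: emb_def place_def)

lemma emb_turn: "emb (turn u) = turn (emb u)"
  by (simp add: emb_def turn_def)

lemma unturn_turn [simp]: "unturn (turn z) = z"
  by (simp add: unturn_def turn_def prod_eq_iff)

lemma turn_unturn [simp]: "turn (unturn z) = z"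
  by (simp add: unturn_def turn_def prod_eq_iff field_simps)

lemma place_inj: "place i x = place i y \<longleftrightarrow> x = y"
  for x y :: "'a::comm_ring_1 \<times> 'a"
  by (auto simp: place_def prod_eq_iff)

lemma unturn_in_tri: "unturn z \<in> tri \<longleftrightarrow> z \<in> etri"
  by (auto simp: unturn_def tri_def etri_def field_simps)

lemma unturn_in_tri_interior: "unturn z \<in> tri_interior \<longleftrightarrow> z \<in> etri_interior"
  by (auto simp: unturn_def tri_interior_def etri_interior_def field_simps)

lemma place_tri_subset: "i < 5 \<Longrightarrow> z \<in> tri \<Longrightarrow> place i z \<in> etri"
  unfolding lt5 by (auto simp: place_def tri_def etri_def)

lemma place_tri_interior_subset: "i < 5 \<Longrightarrow> z \<in> tri_interior \<Longrightarrow> place i z \<in> etri_interior"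
  unfolding lt5 by (auto simp: place_def tri_interior_def etri_interior_def)

lemma place_interior_disjoint:
  assumes "i < 5" "j < 5" "y \<in> tri_interior" "z \<in> tri" "place i y = place j z"
  shows "i = j"
  using assms unfolding lt5
  by (auto simp: place_def tri_interior_def tri_def prod_eq_iff)

section \<open>Incidences inside one dissection\<close>

definition tile_cond :: "nat \<Rightarrow> plane \<Rightarrow> bool" where
  "tile_cond j z \<longleftrightarrow>
    (if j = 0 then fst z \<le> 2 \<and> snd z \<le> 0 \<and> 0 \<le> fst z + 2 * snd z
     else if j = 1 then fst z \<le> 1 \<and> 0 \<le> snd z \<and> snd z \<le> 2 * fst z
     else if j = 2 then fst z \<le> 2 \<and> 0 \<le> snd z \<and> snd z \<le> 2 * fst z - 2
     else if j = 3 then 1 \<le> fst z \<and> snd z \<le> 2 \<and> 2 * fst z - 2 \<le> snd z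
     else fst z \<le> 2 \<and> 2 \<le> snd z \<and> snd z \<le> 2 * fst z)"

lemma place_tri_cond: "z \<in> tri \<Longrightarrow> j < 5 \<Longrightarrow> tile_cond j (place j z)"
  unfolding lt5 by (auto simp: place_def tri_def tile_cond_def)

text \<open>The node images are finitely many integer points. Each is tested against the
  inequalities \<open>tile_cond j\<close> of tile \<open>j\<close>: either one of them fails or a
  node of tile \<open>j\<close> sits there. The point \<open>(1,0)\<close>, where corners of three
  children meet the midpoint node of child \<open>0\<close>, shows why flat nodes are
  needed.\<close>

lemma point_in_tile:
  assumes "i < 5" "u \<in> nodes" "j < 5" "z \<in> tri" "emb (place i u) = place j z"
  shows "\<exists>w\<in>nodes. place i u = place j w"
proof -
  have "tile_cond j (emb (place i u))" using assms place_tri_cond by metis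
  then show ?thesis using assms(1-3) unfolding lt5 nodes_def
    by (elim disjE insertE; simp add: place_def emb_def tile_cond_def)
qed

lemma open_segment_emb:
  "z \<in> open_segment (emb u) (emb w) \<longleftrightarrow> u \<noteq> w \<and> (\<exists>t. 0 < t \<and> t < 1 \<and>
     z = ((1 - t) * of_int (fst u) + t * of_int (fst w), (1 - t) * of_int (snd u) + t * of_int (snd w)))"
  by (auto simp: in_segment emb_def prod_eq_iff)

text \<open>The same test with a parameter: if the edge does not belong to tile \<open>j\<close>,
  some inequality fails for every \<open>0 < t < 1\<close>. The last conjunct remembers whether the
  edge is a hypotenuse, since the two edge lengths are substituted differently.\<close>

lemma edge_in_tile:
  assumes "i < 5" "(u,w,k) \<in> darts" "j < 5" "y \<in> tri"
    "place j y \<in> open_segment (emb (place i u)) (emb (place i w))"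
  shows "\<exists>(u',w',k')\<in>darts. place i u = place j u' \<and> place i w = place j w' \<and> (k = 7 \<longleftrightarrow> k' = 7)"
proof -
  obtain t where t: "0 < t" "t < 1" "place j y = ((1 - t) * of_int (fst (place i u)) + t * of_int (fst (place i w)), (1 - t) * of_int (snd (place i u)) + t * of_int (snd (place i w)))"
    using assms(5) unfolding open_segment_emb by blast
  have "tile_cond j (place j y)" using assms place_tri_cond by metis
  then have c: "tile_cond j ((1 - t) * of_int (fst (place i u)) + t * of_int (fst (place i w)), (1 - t) * of_int (snd (place i u)) + t * of_int (snd (place i w)))"
    using t(3) by simp
  have d: "(u,w,k) = ((0,0),(1,0),0) \<or> (u,w,k) = ((1,0),(0,0),0) \<or> (u,w,k) = ((0,0),(0,1),2) \<or> (u,w,k) = ((0,1),(0,0),2) \<or> 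
           (u,w,k) =  ((0,1),(0,2),6) \<or> (u,w,k) = ((0,2),(0,1),6) \<or> (u,w,k) = ((1,0),(0,2),7) \<or> (u,w,k) = ((0,2),(1,0),7)"
    using assms(2) by (simp add: darts_def)
  show ?thesis
    using assms(1,3) d c t(1,2) unfolding lt5 
    by (elim disjE; simp add: place_def tile_cond_def darts_def algebra_simps)
qed

lemma place_simps:
  "place 0 (x, y) = (2 - y, - x)" "place (Suc 0) (x, y) = (1 - x, y)" "place 2 (x, y) = (2 - x, y)"
  "place 3 (x, y) = (1 + x, 2 - y)" "place 4 (x, y) = (2 - x, 2 + y)"
  by (simp_all add: place_def)

lemma shift_simps: "shift 0 = 1" "shift (Suc 0) = 7" "shift 2 = 3" "shift 3 = 3" "shift 4 = 3"
  by (simp_all add: shift_def)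

text \<open>A parent edge of length \<open>1\<close>, expanded by \<open>sqrt 5\<close>, is the
  hypotenuse of a child. The colours are added because the child sees the negative of the parent
  colour.\<close>

definition old_dart :: "nat \<Rightarrow> (int \<times> int) \<times> (int \<times> int) \<times> int \<Rightarrow> bool" where
  "old_dart i = (\<lambda>(u,w,a). a = 7 \<and>
     (\<exists>(v,v',b)\<in>darts. b \<noteq> 7 \<and> place i u = turn v \<and> place i w = turn v' \<and> 8 dvd (shift i + a) + b))"

text \<open>The five unit edges on the expanded hypotenuse, which runs from \<open>(2,-1)\<close> to
  \<open>(2,4)\<close>. Their colours depend on the parity of the lower end; replacing
  \<open>y\<close> by \<open>3 - y\<close> moves the lower end from \<open>y\<close> to
  \<open>2 - y\<close>, so the pattern is symmetric.\<close>

definition hyp_dart :: "nat \<Rightarrow> (int \<times> int) \<times> (int \<times> int) \<times> int \<Rightarrow> bool" where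
  "hyp_dart i = (\<lambda>(u,w,a). a \<noteq> 7 \<and> fst (place i u) = 2 \<and> fst (place i w) = 2 \<and>
     \<bar>snd (place i u) - snd (place i w)\<bar> = 1 \<and>
     -1 \<le> snd (place i u) \<and> -1 \<le> snd (place i w) \<and> snd (place i u) \<le> 4 \<and> snd (place i w) \<le> 4 \<and>
     (shift i + a) mod 8 = (if even (min (snd (place i u)) (snd (place i w))) then 5 else 1))"

text \<open>The inequalities put the midpoint strictly inside the expanded tile, with sums in place
  of halves. The last two conditions say that the octants on both sides of the dart, at its start,
  are occupied by children of the same parent; this shuts out tiles of other parents.\<close>

definition inner_dart :: "nat \<Rightarrow> (int \<times> int) \<times> (int \<times> int) \<times> int \<Rightarrow> bool" where
  "inner_dart i = (\<lambda>(u,w,a). fst (place i u) + fst (place i w) < 4 \<and>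
     0 < fst (place i u) + fst (place i w) + 2 * (snd (place i u) + snd (place i w)) \<and>
     snd (place i u) + snd (place i w) < 2 * (fst (place i u) + fst (place i w)) \<and>
     (\<exists>j<5. \<exists>(v,b)\<in>octants. place j v = place i u \<and> 8 dvd (shift j + b) - (shift i + a)) \<and>
     (\<exists>j<5. \<exists>(v,b)\<in>octants. place j v = place i u \<and> 8 dvd (shift j + b) - (shift i + a - 1)))"


section \<open>Finite checks on one dissection\<close>

lemma child_octants_disjoint:
  "\<forall>i<5. \<forall>j<5. \<forall>(u,a)\<in>octants. \<forall>(v,b)\<in>octants.
     place i u = place j v \<and> 8 dvd (shift i + a) - (shift j + b) \<longrightarrow> i = j"
  unfolding old_dart_def hyp_dart_def inner_dart_def octants_def darts_def nodes_def all_less5 ex_less5 ball_simps bex_simps prod.case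
  by (simp add: place_simps shift_simps turn_def)

lemma child_darts_consistent:
  "\<forall>i<5. \<forall>j<5. \<forall>(u,w,a)\<in>darts. \<forall>(u',w',b)\<in>darts. place i u = place j u' \<longrightarrow>
     (place i w = place j w' \<longleftrightarrow> 8 dvd (shift i + a) - (shift j + b))"
  unfolding old_dart_def hyp_dart_def inner_dart_def octants_def darts_def nodes_def all_less5 ex_less5 ball_simps bex_simps prod.case
  by (simp add: place_simps shift_simps turn_def)

text \<open>Reversing the orientation turns the octant from \<open>c\<close> to \<open>c + 1\<close>
  into the one from \<open>- c - 1\<close> to \<open>- c\<close>; hence the
  \<open>- 1\<close>.\<close>

lemma child_octant_at_node:
  "\<forall>i<5. \<forall>(u,a)\<in>octants. \<forall>v\<in>nodes. place i u = turn v \<longrightarrow> (v, (- shift i - a - 1) mod 8) \<in> octants"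
  unfolding old_dart_def hyp_dart_def inner_dart_def octants_def darts_def nodes_def all_less5 ex_less5 ball_simps bex_simps prod.case
  by (simp add: place_simps shift_simps turn_def)

lemma child_node_cases:
  "\<forall>i<5. \<forall>u\<in>nodes. place i u \<in> turn ` nodes \<or>
     fst (place i u) = 2 \<and> 0 \<le> snd (place i u) \<and> snd (place i u) \<le> 3 \<or>
     place i u = (1,0) \<or> place i u = (1,1)"
  unfolding old_dart_def hyp_dart_def inner_dart_def octants_def darts_def nodes_def all_less5 ex_less5 ball_simps bex_simps prod.case
  by (simp add: place_simps shift_simps turn_def)

text \<open>At a point dividing the hypotenuse the children fill a half-plane, with octants
  \<open>1\<close> to \<open>4\<close> at even and \<open>5\<close> to \<open>8\<close> at odd
  height. As \<open>y\<close> and \<open>3 - y\<close> have different parity, parents glued along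
  reversed hypotenuses contribute complementary halves.\<close>

lemma child_octant_at_hyp:
  "\<forall>i<5. \<forall>(u,a)\<in>octants. fst (place i u) = 2 \<and> 0 \<le> snd (place i u) \<and> snd (place i u) \<le> 3 \<longrightarrow>
     (even (snd (place i u)) \<longleftrightarrow> (shift i + a) mod 8 \<in> {1,2,3,4})"
  unfolding old_dart_def hyp_dart_def inner_dart_def octants_def darts_def nodes_def all_less5 ex_less5 ball_simps bex_simps prod.case
  by (simp add: place_simps shift_simps turn_def)

lemma child_dart_cases:
  "\<forall>i<5. \<forall>d\<in>darts. old_dart i d \<or> hyp_dart i d \<or> inner_dart i d"
  unfolding old_dart_def hyp_dart_def inner_dart_def octants_def darts_def nodes_def all_less5 ex_less5 ball_simps bex_simps prod.case
  by (simp add: place_simps shift_simps turn_def)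

lemma dart_octant:
  "\<forall>(u,w,a)\<in>darts. u \<in> nodes \<and> w \<in> nodes \<and> u \<noteq> w \<and> (w,u,a) \<in> darts \<and> ((u,a) \<in> octants \<or> (u, (a - 1) mod 8) \<in> octants)"
  unfolding old_dart_def hyp_dart_def inner_dart_def octants_def darts_def nodes_def all_less5 ex_less5 ball_simps bex_simps prod.case
  by (simp add: place_simps shift_simps turn_def)

lemma leg_dart_child:
  "\<forall>(v,v',b)\<in>darts. b \<noteq> 7 \<longrightarrow> (\<exists>i<5. \<exists>(u,w,a)\<in>darts. a = 7 \<and> place i u = turn v \<and> place i w = turn v')"
  unfolding old_dart_def hyp_dart_def inner_dart_def octants_def darts_def nodes_def all_less5 ex_less5 ball_simps bex_simps prod.case
  by (simp add: place_simps shift_simps turn_def)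

lemma hyp_dart_child:
  "\<forall>y\<in>{-1,0,1,2,3}. (\<exists>i<5. \<exists>(u,w,a)\<in>darts. a \<noteq> 7 \<and> place i u = (2,y) \<and> place i w = (2,y+1))"
  unfolding old_dart_def hyp_dart_def inner_dart_def octants_def darts_def nodes_def all_less5 ex_less5 ball_simps bex_simps prod.case
  by (simp add: place_simps shift_simps turn_def)

lemma old_points_are_child_nodes:
  "\<forall>v\<in>nodes. \<exists>i<5. \<exists>u\<in>nodes. place i u = turn v"
  "\<forall>y\<in>{0,1,2,3}. \<exists>i<5. \<exists>u\<in>nodes. place i u = (2, y)"
  unfolding nodes_def all_less5 ex_less5 ball_simps bex_simps prod.case
  by (simp_all add: place_simps shift_simps turn_def)

section \<open>Compatibility of the tiles of a supertile\<close>

definition affine_map :: "(plane \<Rightarrow> plane) \<Rightarrow> bool" where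
  "affine_map G \<longleftrightarrow> (\<forall>x y t. G ((1 - t) *\<^sub>R x + t *\<^sub>R y) = (1 - t) *\<^sub>R G x + t *\<^sub>R G y)"

text \<open>The induction hypothesis for two tiles of one level, seen from the first. Its clauses
  support each other: those on interiors, edges and nodes force contacts to be edge to edge, the
  octant clause leaves no overlap of deformed angles, and the last clause makes the colours at a
  node determine the edges and conversely.\<close>

definition compatible :: "ltile \<Rightarrow> ltile \<Rightarrow> bool" where
  "compatible s t \<longleftrightarrow>
    (\<forall>z\<in>tri_interior. fst s z \<in> fst t ` tri \<longrightarrow> s = t) \<and>
    (\<forall>(u,w,a)\<in>darts. \<forall>z\<in>open_segment (emb u) (emb w). fst s z \<in> fst t ` tri \<longrightarrow>
       (\<exists>(u',w',b)\<in>darts. fst s (emb u) = fst t (emb u') \<and> fst s (emb w) = fst t (emb w') \<and>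
          (a = 7 \<longleftrightarrow> b = 7))) \<and>
    (\<forall>u\<in>nodes. fst s (emb u) \<in> fst t ` tri \<longrightarrow> (\<exists>v\<in>nodes. fst s (emb u) = fst t (emb v))) \<and>
    (\<forall>(u,a)\<in>octants. \<forall>(v,b)\<in>octants.
       fst s (emb u) = fst t (emb v) \<and> 8 dvd (snd s + a) - (snd t + b) \<longrightarrow> s = t) \<and>
    (\<forall>(u,w,a)\<in>darts. \<forall>(u',w',b)\<in>darts. fst s (emb u) = fst t (emb u') \<longrightarrow>
       (fst s (emb w) = fst t (emb w') \<longleftrightarrow> 8 dvd (snd s + a) - (snd t + b)))"

lemma compatible_interior:
  "compatible s t \<Longrightarrow> z \<in> tri_interior \<Longrightarrow> fst s z = fst t z' \<Longrightarrow> z' \<in> tri \<Longrightarrow> s = t"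
  unfolding compatible_def by blast

lemma compatible_edge:
  assumes "compatible s t" "(u,w,a) \<in> darts" "z \<in> open_segment (emb u) (emb w)" "fst s z = fst t z'" "z' \<in> tri"
  obtains u' w' b where "(u',w',b) \<in> darts" "fst s (emb u) = fst t (emb u')"
    "fst s (emb w) = fst t (emb w')" "a = 7 \<longleftrightarrow> b = 7"
proof -
  have "\<exists>(u',w',b)\<in>darts. fst s (emb u) = fst t (emb u') \<and> fst s (emb w) = fst t (emb w') \<and> (a = 7 \<longleftrightarrow> b = 7)"
    using assms unfolding compatible_def by blast
  then show thesis using that by blast
qed

lemma compatible_node:
  assumes "compatible s t" "u \<in> nodes" "fst s (emb u) = fst t z'" "z' \<in> tri"
  obtains v where "v \<in> nodes" "fst s (emb u) = fst t (emb v)"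
  using assms unfolding compatible_def by blast

lemma compatible_octant:
  "compatible s t \<Longrightarrow> (u,a) \<in> octants \<Longrightarrow> (v,b) \<in> octants \<Longrightarrow> fst s (emb u) = fst t (emb v) \<Longrightarrow>
   8 dvd (snd s + a) - (snd t + b) \<Longrightarrow> s = t"
  unfolding compatible_def by blast

lemma compatible_dart:
  "compatible s t \<Longrightarrow> (u,w,a) \<in> darts \<Longrightarrow> (u',w',b) \<in> darts \<Longrightarrow> fst s (emb u) = fst t (emb u') \<Longrightarrow>
   fst s (emb w) = fst t (emb w') \<longleftrightarrow> 8 dvd (snd s + a) - (snd t + b)"
  unfolding compatible_def by blast

lemma affine_mapD:
  "affine_map G \<Longrightarrow> G ((1 - t) *\<^sub>R x + t *\<^sub>R y) = (1 - t) *\<^sub>R G x + t *\<^sub>R G y"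
  unfolding affine_map_def by blast

lemma affine_map_comp: "affine_map F \<Longrightarrow> affine_map G \<Longrightarrow> affine_map (F \<circ> G)"
  unfolding affine_map_def comp_def by metis

lemma affine_unturn: "affine_map unturn"
  by (simp add: affine_map_def unturn_def prod_eq_iff field_simps)

lemma affine_place: "affine_map (place i)"
  by (simp add: affine_map_def place_def prod_eq_iff algebra_simps)

lemma inj_unturn: "inj unturn"
  by (metis injI turn_unturn)

lemma inj_place: "inj (place i :: plane \<Rightarrow> plane)"
  by (simp add: inj_def place_inj)

lemma affine_open_segment:
  assumes "affine_map G" "inj G"
  shows "G z \<in> open_segment (G x) (G y) \<longleftrightarrow> z \<in> open_segment x y"
  using assms(2) by (auto simp: in_segment affine_mapD[OF assms(1), symmetric] inj_eq)

lemma nodes_in_tri: "u \<in> nodes \<Longrightarrow> emb u \<in> tri"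
  by (auto simp: nodes_def emb_def tri_def)

lemma place_in_etri: "i < 5 \<Longrightarrow> u \<in> nodes \<Longrightarrow> emb (place i u) \<in> etri"
  by (simp add: emb_place nodes_in_tri place_tri_subset)

lemma unturn_emb_turn [simp]: "unturn (emb (turn u)) = emb u"
  by (simp add: emb_turn)

lemma hyp_param: "unturn (2, y) = (1 - (y + 1) / 5) *\<^sub>R (1, 0) + ((y + 1) / 5) *\<^sub>R (0, 2)"
  by (simp add: unturn_def field_simps)

lemma emb_corners: "emb (1,0) = (1,0)" "emb (0,2) = (0,2)"
  by (simp_all add: emb_def)

lemma hyp_darts: "(u,w,a) \<in> darts \<Longrightarrow> a = 7 \<Longrightarrow> u = (1,0) \<and> w = (0,2) \<or> u = (0,2) \<and> w = (1,0)"
  by (auto simp: darts_def)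

lemma dvd_diff_mod8: "8 dvd (p + A mod 8) - (q + B mod 8) \<longleftrightarrow> 8 dvd (p + A) - (q + B)" for p q A B :: int
  by (simp add: mod_eq_dvd_iff[symmetric] mod_simps)

lemma dvd_neg_eq: "d dvd x \<Longrightarrow> y = - x \<Longrightarrow> d dvd y" for x y d :: int
  by simp

text \<open>Each linear form bounding the triangle is nonnegative at both ends, and its two end
  values have a positive sum; so it is positive at every proper convex combination.\<close>

lemma inner_dart_segment:
  assumes "i < 5" "u \<in> nodes" "w \<in> nodes" "inner_dart i (u,w,a)"
    "z \<in> open_segment (emb (place i u)) (emb (place i w))"
  shows "z \<in> etri_interior"
proof -
  obtain t where t: "0 < t" "t < 1" "z = ((1 - t) * of_int (fst (place i u)) + t * of_int (fst (place i w)), (1 - t) * of_int (snd (place i u)) + t * of_int (snd (place i w)))"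
    using assms(5) unfolding open_segment_emb by blast
  have pos: "0 < (1 - t) * p + t * q" if "0 \<le> p" "0 \<le> q" "0 < p + q" for p q :: real
  proof (cases "p = 0")
    case True then show ?thesis using that t by simp
  next
    case False then have "0 < (1 - t) * p" using that t by simp
    then show ?thesis using that t by (simp add: add_pos_nonneg)
  qed
  define X Y X' Y' where "X = real_of_int (fst (place i u))" "Y = real_of_int (snd (place i u))"
    "X' = real_of_int (fst (place i w))" "Y' = real_of_int (snd (place i w))"
  have 1: "X \<le> 2" "0 \<le> X + 2 * Y" "Y \<le> 2 * X" "X' \<le> 2" "0 \<le> X' + 2 * Y'" "Y' \<le> 2 * X'"
    using place_in_etri[OF assms(1,2)] place_in_etri[OF assms(1,3)] by (auto simp: etri_def emb_def X_Y_X'_Y'_def)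
  have "real_of_int (fst (place i u) + fst (place i w)) < real_of_int 4"
    "real_of_int 0 < real_of_int (fst (place i u) + fst (place i w) + 2 * (snd (place i u) + snd (place i w)))"
    "real_of_int (snd (place i u) + snd (place i w)) < real_of_int (2 * (fst (place i u) + fst (place i w)))"
    using assms(4) unfolding inner_dart_def prod.case of_int_less_iff by blast+
  then have 2: "X + X' < 4" "0 < X + X' + 2 * (Y + Y')" "Y + Y' < 2 * (X + X')"
    unfolding X_Y_X'_Y'_def by simp_all
  have 3: "z = ((1 - t) * X + t * X', (1 - t) * Y + t * Y')" using t(3) by (simp add: X_Y_X'_Y'_def)
  have "0 < (1 - t) * (2 - X) + t * (2 - X')"
    using 1 2 by (intro pos) (simp_all add: algebra_simps)
  moreover have "0 < (1 - t) * (X + 2 * Y) + t * (X' + 2 * Y')"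
    using 1 2 by (intro pos) (simp_all add: algebra_simps)
  moreover have "0 < (1 - t) * (2 * X - Y) + t * (2 * X' - Y')"
    using 1 2 by (intro pos) (simp_all add: algebra_simps)
  ultimately show ?thesis unfolding etri_interior_def 3 by (simp add: algebra_simps)
qed

section \<open>Contacts between the children of two distinct parents\<close>

locale tile_pair =
  fixes G G' :: "plane \<Rightarrow> plane" and \<psi> \<psi>' :: int
  assumes comp: "compatible (G,\<psi>) (G',\<psi>')" and comp': "compatible (G',\<psi>') (G,\<psi>)"
    and affine: "affine_map G" "affine_map G'" and inj: "inj G" "inj G'"
    and distinct: "(G,\<psi>) \<noteq> (G',\<psi>')"
begin

lemma swap: "tile_pair G' G \<psi>' \<psi>"
  using comp comp' affine inj distinct by unfold_locales auto

lemma not_interior: "z \<in> etri_interior \<Longrightarrow> z' \<in> etri \<Longrightarrow> G (unturn z) \<noteq> G' (unturn z')"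
  using compatible_interior[OF comp] distinct unturn_in_tri unturn_in_tri_interior by fastforce

lemma mirror:
  assumes "G (1,0) = G' (0,2)" "G (0,2) = G' (1,0)"
  shows "G (unturn (2, y)) = G' (unturn (2, 3 - y))"
proof -
  have "G' (unturn (2, 3 - y)) = (1 - (4 - y) / 5) *\<^sub>R G' (1, 0) + ((4 - y) / 5) *\<^sub>R G' (0, 2)"
    unfolding hyp_param affine_mapD[OF affine(2)] by simp
  also have "\<dots> = (1 - (y + 1) / 5) *\<^sub>R G' (0, 2) + ((y + 1) / 5) *\<^sub>R G' (1, 0)"
    by (simp add: field_simps)
  finally show ?thesis unfolding hyp_param affine_mapD[OF affine(1)] using assms by simp
qed

text \<open>The edge clause makes the hypotenuses coincide. With equal orientation their colours
  would agree, and then the octants at \<open>(1,0)\<close> would clash; so they are reversed, and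
  an affine injective map admits only the point \<open>(2, 3 - y)\<close>.\<close>

lemma shared_hyp:
  assumes "-1 < y" "y < 4" "G (unturn (2, y)) = G' (unturn z')" "z' \<in> etri"
  shows "G (1,0) = G' (0,2) \<and> G (0,2) = G' (1,0) \<and> 8 dvd \<psi> - \<psi>' \<and> z' = (2, 3 - y)"
proof -
  have d: "((1,0),(0,2),7) \<in> darts" "((0,2),(1,0),7) \<in> darts" by (simp_all add: darts_def)
  have "unturn (2,y) \<in> open_segment (emb (1,0)) (emb (0,2))"
    unfolding emb_corners in_segment hyp_param using assms(1,2)
    by (auto simp: prod_eq_iff intro!: exI[of _ "(y+1)/5"])
  then obtain u' w' b where e: "(u',w',b) \<in> darts" "G (emb (1,0)) = G' (emb u')"
    "G (emb (0,2)) = G' (emb w')" "b = 7"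
    using compatible_edge[OF comp d(1)] assms(3,4) unturn_in_tri fst_conv by metis
  have "\<not> (u' = (1,0) \<and> w' = (0,2))"
  proof
    assume *: "u' = (1,0) \<and> w' = (0,2)"
    have "8 dvd (\<psi> + 7) - (\<psi>' + 7)" using compatible_dart[OF comp d(1) d(1)] e * by simp
    moreover have "((1,0),7) \<in> octants" by (simp add: octants_def)
    ultimately have "(G,\<psi>) = (G',\<psi>')" using compatible_octant[OF comp, of "(1,0)" 7 "(1,0)" 7] e * by simp
    then show False using distinct by simp
  qed
  then have *: "u' = (0,2)" "w' = (1,0)" using hyp_darts e by blast+
  have "8 dvd (\<psi> + 7) - (\<psi>' + 7)" using compatible_dart[OF comp d(1) d(2)] e * by simp
  moreover have c: "G (1,0) = G' (0,2)" "G (0,2) = G' (1,0)" using e * by (simp_all add: emb_corners)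
  moreover have "G' (unturn z') = G' (unturn (2, 3 - y))" using assms(3) mirror[OF c] by simp
  then have "z' = (2, 3 - y)" using inj(2) inj_unturn by (metis inj_eq)
  ultimately show ?thesis by simp
qed

text \<open>By the position of the point in its own parent: an old node is matched through the
  parents, a dividing point of the hypotenuse by the reversal, and an interior point cannot be
  shared.\<close>

lemma shared_point:
  assumes "i < 5" "u \<in> nodes" "G (unturn (emb (place i u))) = G' (unturn z')" "z' \<in> etri"
  shows "(\<exists>v\<in>nodes. \<exists>v'\<in>nodes. place i u = turn v \<and> z' = emb (turn v') \<and> G (emb v) = G' (emb v')) \<or>
    (\<exists>y\<in>{0,1,2,3}. place i u = (2, y) \<and> z' = emb (2, 3 - y) \<and>
      G (1,0) = G' (0,2) \<and> G (0,2) = G' (1,0) \<and> 8 dvd \<psi> - \<psi>')"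
proof -
  consider (node) v where "v \<in> nodes" "place i u = turn v"
    | (hyp) "fst (place i u) = 2" "0 \<le> snd (place i u)" "snd (place i u) \<le> 3"
    | (inner) "place i u = (1,0) \<or> place i u = (1,1)"
    using child_node_cases assms(1,2) by blast
  then show ?thesis
  proof cases
    case node
    then have *: "G (emb v) = G' (unturn z')" using assms(3) by simp
    obtain v' where v': "v' \<in> nodes" "G (emb v) = G' (emb v')"
      using compatible_node[OF comp node(1)] * assms(4) unturn_in_tri fst_conv by metis
    then have "unturn z' = unturn (emb (turn v'))" using inj(2) * by (simp add: inj_eq)
    then have "z' = emb (turn v')" by (metis turn_unturn emb_turn unturn_emb_turn)
    then show ?thesis using node v' by blast
  next
    case hyp
    obtain y where y: "place i u = (2,y)" using hyp by (metis prod.collapse)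
    have "emb (place i u) = (2, of_int y)" by (simp add: y emb_def)
    then show ?thesis using shared_hyp[of "of_int y" z'] assms(3,4) hyp y
      by (auto simp: emb_def)
  next
    case inner
    then have "emb (place i u) \<in> etri_interior" by (auto simp: emb_def etri_interior_def)
    then show ?thesis using not_interior assms by blast
  qed
qed

text \<open>At an old node a common octant would descend from a common octant of the parents. On a
  hypotenuse the parent colours agree modulo \<open>8\<close>, so the complementary half-planes at
  heights \<open>y\<close> and \<open>3 - y\<close> keep the octants apart.\<close>

lemma octants_step:
  assumes "i < 5" "j < 5" "(u,a) \<in> octants" "(u',b) \<in> octants"
    "G (unturn (emb (place i u))) = G' (unturn (emb (place j u')))"
  shows "\<not> 8 dvd (shift i - \<psi> + a) - (shift j - \<psi>' + b)"
proof
  assume dv: "8 dvd (shift i - \<psi> + a) - (shift j - \<psi>' + b)"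
  have n: "u \<in> nodes" "u' \<in> nodes" using assms(3,4) by (auto simp: octants_def nodes_def)
  from shared_point[OF assms(1) n(1) assms(5) place_in_etri[OF assms(2) n(2)]] show False
  proof (elim disjE bexE conjE)
    fix v v' assume v: "v \<in> nodes" "v' \<in> nodes" "place i u = turn v" "emb (place j u') = emb (turn v')" "G (emb v) = G' (emb v')"
    have o1: "(v, (- shift i - a - 1) mod 8) \<in> octants" using child_octant_at_node assms(1,3) v by blast
    have o2: "(v', (- shift j - b - 1) mod 8) \<in> octants" using child_octant_at_node assms(2,4) v by fastforce
    have "8 dvd (\<psi> + (- shift i - a - 1) mod 8) - (\<psi>' + (- shift j - b - 1) mod 8)"
      unfolding dvd_diff_mod8 using dv by (rule dvd_neg_eq) simp
    then have "(G,\<psi>) = (G',\<psi>')" using compatible_octant[OF comp o1 o2] v by simp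
    then show False using distinct by simp
  next
    fix y :: int assume y: "y \<in> {0,1,2,3}" "place i u = (2, y)" "emb (place j u') = emb (2, 3 - y)" "8 dvd \<psi> - \<psi>'"
    have "even y \<longleftrightarrow> (shift i + a) mod 8 \<in> {1,2,3,4}"
      using child_octant_at_hyp assms(1,3) y(1,2) by fastforce
    moreover have "place j u' = (2, 3 - y)" using y(3) by simp
    then have "even (3 - y) \<longleftrightarrow> (shift j + b) mod 8 \<in> {1,2,3,4}"
      using child_octant_at_hyp assms(2,4) y(1) by fastforce
    moreover have "(shift i + a) mod 8 = (shift j + b) mod 8"
      unfolding mod_eq_dvd_iff using dvd_add[OF dv y(4)] by (simp add: algebra_simps)
    moreover have "even (3 - y) \<longleftrightarrow> odd y" by simp
    ultimately show False by metis
  qed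
qed

lemma node_step:
  assumes "i < 5" "j < 5" "u \<in> nodes" "z \<in> tri" "G (unturn (emb (place i u))) = G' (unturn (place j z))"
  shows "\<exists>v\<in>nodes. G (unturn (emb (place i u))) = G' (unturn (emb (place j v)))"
proof -
  \<comment> \<open>The point is first recognised as a node of some child of the second parent;
    \<open>point_in_tile\<close> then passes to child \<open>j\<close> within that single
    dissection.\<close>
  have "\<exists>i'<5. \<exists>u'\<in>nodes. place j z = emb (place i' u')"
    using shared_point[OF assms(1,3,5) place_tri_subset[OF assms(2,4)]]
    proof (elim disjE bexE conjE)
    fix v v' assume "v' \<in> nodes" "place j z = emb (turn v')"
    then show ?thesis using old_points_are_child_nodes(1) by metis
  next
    fix y :: int assume "y \<in> {0,1,2,3}" "place j z = emb (2, 3 - y)"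
    moreover then have "3 - y \<in> {0,1,2,3}" by auto
    ultimately show ?thesis using old_points_are_child_nodes(2) by metis
  qed
  then obtain i' u' where *: "i' < 5" "u' \<in> nodes" "emb (place i' u') = place j z" by metis
  then obtain w where "w \<in> nodes" "place i' u' = place j w" using point_in_tile[OF *(1,2) assms(2,4) *(3)] by blast
  then show ?thesis using * assms(5) by metis
qed

text \<open>The edge is carried over to an edge of some child of the second parent, along a common
  leg edge of the parents or by the reversal of their hypotenuse; \<open>edge_in_tile\<close> then
  compares it with child \<open>j\<close>. Inner edges do not reach the other parent.\<close>

lemma edge_step:
  assumes "i < 5" "j < 5" "(u,w,a) \<in> darts" "z \<in> open_segment (emb u) (emb w)" "y \<in> tri"
    "G (unturn (place i z)) = G' (unturn (place j y))"
  shows "\<exists>u' w' b. (u',w',b) \<in> darts \<and> G (unturn (emb (place i u))) = G' (unturn (emb (place j u'))) \<and>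
     G (unturn (emb (place i w))) = G' (unturn (emb (place j w'))) \<and> (a = 7 \<longleftrightarrow> b = 7)"
proof -
  have n: "u \<in> nodes" "w \<in> nodes" using dart_octant assms(3) by blast+
  have pz: "place i z \<in> open_segment (emb (place i u)) (emb (place i w))"
    using affine_open_segment[OF affine_place inj_place] assms(4) by (simp add: emb_place)
  have py: "place j y \<in> etri" using assms place_tri_subset by blast
  consider "old_dart i (u,w,a)" | "hyp_dart i (u,w,a)" | "inner_dart i (u,w,a)" 
    using child_dart_cases assms(1,3) by blast
  then show ?thesis
  proof cases
    case 1
    then obtain v v' c where v: "(v,v',c) \<in> darts" "c \<noteq> 7" "place i u = turn v" "place i w = turn v'" "a = 7"
      unfolding old_dart_def by auto
    have "unturn (place i z) \<in> open_segment (emb v) (emb v')"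
      using affine_open_segment[OF affine_unturn inj_unturn] pz v by (metis unturn_emb_turn)
    then obtain p q b where p: "(p,q,b) \<in> darts" "G (emb v) = G' (emb p)" "G (emb v') = G' (emb q)" "b \<noteq> 7"
      using compatible_edge[OF comp v(1)] assms(6) py unturn_in_tri fst_conv v(2) by metis
    have "G (unturn (place i z)) \<in> open_segment (G (emb v)) (G (emb v'))"
      using affine_open_segment[OF affine(1) inj(1)] \<open>unturn (place i z) \<in> _\<close> by blast
    then have "G' (unturn (place j y)) \<in> open_segment (G' (emb p)) (G' (emb q))" using p assms(6) by simp
    then have "unturn (place j y) \<in> open_segment (emb p) (emb q)"
      using affine_open_segment[OF affine(2) inj(2)] by blast
    then have py': "place j y \<in> open_segment (emb (turn p)) (emb (turn q))"
      using affine_open_segment[OF affine_unturn inj_unturn] by (metis unturn_emb_turn)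
    obtain i' u1 w1 where i': "i' < 5" "(u1,w1,7) \<in> darts" "place i' u1 = turn p" "place i' w1 = turn q"
      using leg_dart_child p(1,4) by fastforce
    then obtain u' w' b' where e: "(u',w',b') \<in> darts" "turn p = place j u'" "turn q = place j w'" "b' = 7"
      using edge_in_tile[OF i'(1,2) assms(2,5)] py' by auto
    have "G (unturn (emb (place i u))) = G' (unturn (emb (place j u')))"
      "G (unturn (emb (place i w))) = G' (unturn (emb (place j w')))"
      by (simp_all only: v p e(2,3)[symmetric] unturn_emb_turn)
    moreover have "a = 7 \<longleftrightarrow> b' = 7" using v(5) e(4) by simp
    ultimately show ?thesis using e(1) by metis
  next
    case 2
    define k l where "k = snd (place i u)" "l = snd (place i w)"
    then have kl: "place i u = (2,k)" "place i w = (2,l)" using 2 by (simp_all add: hyp_dart_def prod_eq_iff)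
    have kl': "\<bar>k - l\<bar> = 1" "-1 \<le> k" "-1 \<le> l" "k \<le> 4" "l \<le> 4" "a \<noteq> 7" using 2 by (simp_all add: hyp_dart_def kl)
    obtain t where t: "0 < t" "t < 1" "place i z = ((1 - t) * of_int 2 + t * of_int 2, (1 - t) * of_int k + t * of_int l)"
      using pz unfolding kl open_segment_emb by auto
    define h where "h = (1 - t) * of_int k + t * of_int l"
    have h: "place i z = (2, h)" using t by (simp add: h_def)
    have "l = k + 1 \<or> l = k - 1" using kl' by linarith
    then have hb: "-1 < h" "h < 4" using kl' t(1,2) unfolding h_def by (auto simp: algebra_simps)
    have m: "G (1,0) = G' (0,2)" "G (0,2) = G' (1,0)" "place j y = (2, 3 - h)"
      using shared_hyp[OF hb, of "place j y"] py assms(6) h by auto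
    have seg: "place j y \<in> open_segment (emb (2, 3 - k)) (emb (2, 3 - l))"
      unfolding open_segment_emb m(3) h_def using t kl' by (auto intro!: exI[of _ t] simp: algebra_simps)
    have "\<exists>i'<5. \<exists>u1 w1 a1. (u1,w1,a1) \<in> darts \<and> a1 \<noteq> 7 \<and> place i' u1 = (2, 3 - k) \<and> place i' w1 = (2, 3 - l)"
    proof (cases "l = k + 1")
      case True
      then have "3 - l \<in> {-1,0,1,2,3}" using kl' by auto
      then obtain i' u1 w1 a1 where *: "i' < 5" "(u1,w1,a1) \<in> darts" "a1 \<noteq> 7" "place i' u1 = (2,3-l)" "place i' w1 = (2,3-l+1)"
        using hyp_dart_child by blast
      have d: "(w1,u1,a1) \<in> darts" using dart_octant *(2) by blast
      have "place i' w1 = (2, 3 - k)" using *(5) True by simp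
      then show ?thesis using *(1,3,4) d by blast
    next
      case False
      then have "l = k - 1" "3 - k \<in> {-1,0,1,2,3}" using kl' by auto
      then obtain i' u1 w1 a1 where *: "i' < 5" "(u1,w1,a1) \<in> darts" "a1 \<noteq> 7" "place i' u1 = (2,3-k)" "place i' w1 = (2,3-k+1)"
        using hyp_dart_child by blast
      have "place i' w1 = (2, 3 - l)" using *(5) \<open>l = k - 1\<close> by simp
      then show ?thesis using *(1-4) by blast
    qed
    then obtain i' u1 w1 a1 where i': "i' < 5" "(u1,w1,a1) \<in> darts" "a1 \<noteq> 7" "place i' u1 = (2, 3 - k)" "place i' w1 = (2, 3 - l)" by blast
    then obtain u' w' b' where e: "(u',w',b') \<in> darts" "(2, 3 - k) = place j u'" "(2, 3 - l) = place j w'" "b' \<noteq> 7"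
      using edge_in_tile[OF i'(1,2) assms(2,5)] seg by auto
    have "G (unturn (emb (2, k))) = G' (unturn (emb (2, 3 - k)))" "G (unturn (emb (2, l))) = G' (unturn (emb (2, 3 - l)))"
      using mirror[OF m(1,2), of "of_int k"] mirror[OF m(1,2), of "of_int l"] by (simp_all add: emb_def)
    then have "G (unturn (emb (place i u))) = G' (unturn (emb (place j u')))"
      "G (unturn (emb (place i w))) = G' (unturn (emb (place j w')))"
      by (simp_all only: kl e(2,3)[symmetric])
    moreover have "a = 7 \<longleftrightarrow> b' = 7" using kl'(6) e(4) by simp
    ultimately show ?thesis using e(1) by metis
  next
    case 3
    then have "place i z \<in> etri_interior" using inner_dart_segment[OF assms(1) n _ pz] by simp
    then show ?thesis using not_interior py assms(6) by metis
  qed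
qed

end

text \<open>A dart that leaves an old node along the boundary of the parent either fills a leg edge
  or is the first fifth of the hypotenuse, counted from \<open>(2,-1)\<close> or from
  \<open>(2,4)\<close>.\<close>

lemma outer_dart_at_node:
  assumes "i < 5" "(u,w,a) \<in> darts" "v \<in> nodes" "place i u = turn v" "\<not> inner_dart i (u,w,a)"
  obtains v2 c where "(v,v2,c) \<in> darts" "8 dvd (shift i + a) + c"
    "if c = 7 then v = (1,0) \<and> place i w = (2,0) \<or> v = (0,2) \<and> place i w = (2,3)
     else place i w = turn v2"
proof -
  consider "old_dart i (u,w,a)" | "hyp_dart i (u,w,a)"
    using child_dart_cases assms(1,2,5) by blast
  then show thesis
  proof cases
    case 1
    then obtain v1 v2 c where c: "(v1,v2,c) \<in> darts" "c \<noteq> 7" "place i u = turn v1" "place i w = turn v2"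
      "8 dvd (shift i + a) + c"
      unfolding old_dart_def by auto
    have "turn v1 = turn v" using c(3) assms(4) by simp
    then have "v1 = v" by (simp add: turn_def prod_eq_iff)
    then show thesis using that[of v2 c] c by simp
  next
    case 2
    define l where "l = snd (place i w)"
    have l: "place i w = (2, l)" "\<bar>snd (turn v) - l\<bar> = 1" "-1 \<le> l" "l \<le> 4" "fst (turn v) = 2"
      "(shift i + a) mod 8 = (if even (min (snd (turn v)) l) then 5 else 1)"
      using 2 unfolding l_def by (simp_all add: hyp_dart_def assms(4) prod_eq_iff)
    have "v = (1,0) \<and> l = 0 \<or> v = (0,2) \<and> l = 3"
      using l(2-5) assms(3) by (auto simp: nodes_def turn_def)
    moreover from this l(6) have "(shift i + a) mod 8 = 1" by (auto simp: turn_def)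
    then have "8 dvd (shift i + a) + 7" by presburger
    ultimately show thesis
      using that[of "(0,2)" 7] that[of "(1,0)" 7] l(1) by (auto simp: darts_def)
  qed
qed

lemma darts_functional: "\<forall>(u,w,a)\<in>darts. \<forall>(u',w',b)\<in>darts. u = u' \<and> w = w' \<longrightarrow> a = b"
  unfolding darts_def ball_simps prod.case by simp

lemma darts_octants_root:
  "\<forall>(u,a)\<in>octants. u \<in> nodes"
  "\<forall>(u,w,a)\<in>darts. \<forall>(u',w',b)\<in>darts. u = u' \<longrightarrow> (w = w' \<longleftrightarrow> 8 dvd a - b)"
  unfolding darts_def octants_def nodes_def ball_simps prod.case by simp_all

lemma midpoint_in_open_segment: "x \<noteq> y \<Longrightarrow> (1 - 1/2) *\<^sub>R x + (1/2) *\<^sub>R y \<in> open_segment x y"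
  for x y :: plane
  unfolding in_segment by (intro conjI exI[of _ "1/2"]) auto

lemma midpoint_in_tri: "x \<in> tri \<Longrightarrow> y \<in> tri \<Longrightarrow> (1 - 1/2) *\<^sub>R x + (1/2) *\<^sub>R y \<in> tri"
  by (simp add: tri_def)

lemma midpoint_in_etri: "x \<in> etri \<Longrightarrow> y \<in> etri \<Longrightarrow> (1 - 1/2) *\<^sub>R x + (1/2) *\<^sub>R y \<in> etri"
  by (simp add: etri_def)

lemma dart_nodes:
  assumes "(u,w,a) \<in> darts" shows "u \<in> nodes" "w \<in> nodes" "u \<noteq> w" "(w,u,a) \<in> darts"
    "(u,a) \<in> octants \<or> (u, (a - 1) mod 8) \<in> octants"
  using dart_octant assms by blast+

context tile_pair begin

text \<open>The edge clause of \<open>compatible\<close> speaks of points inside an edge, so it is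
  applied to the common midpoint.\<close>

lemma dart_type:
  assumes "(v,w,a) \<in> darts" "(v',w',b) \<in> darts" "G (emb v) = G' (emb v')" "G (emb w) = G' (emb w')"
  shows "a = 7 \<longleftrightarrow> b = 7"
proof -
  have "G ((1 - 1/2) *\<^sub>R emb v + (1/2) *\<^sub>R emb w) = G' ((1 - 1/2) *\<^sub>R emb v' + (1/2) *\<^sub>R emb w')"
    unfolding affine_mapD[OF affine(1)] affine_mapD[OF affine(2)] assms(3,4) ..
  moreover have "(1 - 1/2) *\<^sub>R emb v' + (1/2) *\<^sub>R emb w' \<in> tri"
    using assms(2) dart_nodes nodes_in_tri by (intro midpoint_in_tri) blast+
  moreover have "(1 - 1/2) *\<^sub>R emb v + (1/2) *\<^sub>R emb w \<in> open_segment (emb v) (emb w)"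
    using dart_nodes(3)[OF assms(1)] by (intro midpoint_in_open_segment) simp
  ultimately obtain p q c where p: "(p,q,c) \<in> darts" "G (emb v) = G' (emb p)" "G (emb w) = G' (emb q)" "a = 7 \<longleftrightarrow> c = 7"
    using compatible_edge[OF comp assms(1)] by (metis fst_conv)
  then have "p = v'" "q = w'" using assms(3,4) inj(2) by (simp_all add: inj_eq)
  then have "c = b" using darts_functional p(1) assms(2) by blast
  then show ?thesis using p(4) by simp
qed

text \<open>The midpoint of the inner edge lies inside its parent, so the edge is not shared. Nor is
  its colour: the other dart bounds an octant of its own tile on one side, and both octants beside
  the inner dart belong to children of the first parent.\<close>

lemma inner_dart_step:
  assumes "i < 5" "j < 5" "(u,w,a) \<in> darts" "(u',w',b) \<in> darts" "inner_dart i (u,w,a)"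
    "G (unturn (emb (place i u))) = G' (unturn (emb (place j u')))"
  shows "G (unturn (emb (place i w))) \<noteq> G' (unturn (emb (place j w')))"
    "\<not> 8 dvd (shift i - \<psi> + a) - (shift j - \<psi>' + b)"
proof -
  note n = dart_nodes[OF assms(3)] and n' = dart_nodes[OF assms(4)]
  show "G (unturn (emb (place i w))) \<noteq> G' (unturn (emb (place j w')))"
  proof
    assume eq: "G (unturn (emb (place i w))) = G' (unturn (emb (place j w')))"
    let ?m = "(1 - 1/2) *\<^sub>R emb (place i u) + (1/2) *\<^sub>R emb (place i w)"
    let ?m' = "(1 - 1/2) *\<^sub>R emb (place j u') + (1/2) *\<^sub>R emb (place j w')"
    have "G (unturn ?m) = G' (unturn ?m')"
      unfolding affine_mapD[OF affine_unturn] affine_mapD[OF affine(1)] affine_mapD[OF affine(2)] eq assms(6) ..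
    moreover have "?m' \<in> etri" using n' assms(2) by (intro midpoint_in_etri place_in_etri)
    moreover have "?m \<in> open_segment (emb (place i u)) (emb (place i w))"
      using n(3) by (intro midpoint_in_open_segment) (simp add: place_inj)
    then have "?m \<in> etri_interior" using inner_dart_segment[OF assms(1) n(1,2) assms(5)] by blast
    ultimately show False using not_interior by blast
  qed
  show "\<not> 8 dvd (shift i - \<psi> + a) - (shift j - \<psi>' + b)"
  proof
    assume dv: "8 dvd (shift i - \<psi> + a) - (shift j - \<psi>' + b)"
    have in1: "\<exists>k<5. \<exists>(v,c)\<in>octants. place k v = place i u \<and> 8 dvd (shift k + c) - (shift i + a)"
      and in2: "\<exists>k<5. \<exists>(v,c)\<in>octants. place k v = place i u \<and> 8 dvd (shift k + c) - (shift i + a - 1)"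
      using assms(5) unfolding inner_dart_def by simp_all
    from n'(5) show False
    proof
      assume o': "(u',b) \<in> octants"
      from in1 obtain k v c where k: "k < 5" "(v,c) \<in> octants" "place k v = place i u" "8 dvd (shift k + c) - (shift i + a)"
        by blast
      have "8 dvd (shift k - \<psi> + c) - (shift j - \<psi>' + b)"
        using dvd_add[OF k(4) dv] by (simp add: algebra_simps)
      then show False using octants_step[OF k(1) assms(2) k(2) o'] k(3) assms(6) by simp
    next
      assume o': "(u',(b-1) mod 8) \<in> octants"
      from in2 obtain k v c where k: "k < 5" "(v,c) \<in> octants" "place k v = place i u" "8 dvd (shift k + c) - (shift i + a - 1)"
        by blast
      have "8 dvd ((shift k - \<psi>) + c) - ((shift j - \<psi>') + (b - 1))"
        using dvd_add[OF k(4) dv] by (simp add: algebra_simps)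
      then have "8 dvd ((shift k - \<psi>) + c) - ((shift j - \<psi>') + (b - 1) mod 8)"
        by (simp add: mod_eq_dvd_iff[symmetric] mod_simps)
      then show False using octants_step[OF k(1) assms(2) k(2) o'] k(3) assms(6) by simp
    qed
  qed
qed

lemma fifth_point:
  assumes "(v,v2,c) \<in> darts" "c = 7" "v = (1,0) \<and> x = (2,0) \<or> v = (0,2) \<and> x = (2,3)"
  shows "unturn (emb x) = (1 - 1/5) *\<^sub>R emb v + (1/5) *\<^sub>R emb v2"
  using hyp_darts[OF assms(1,2)] assms(3) by (auto simp: unturn_def emb_def)

text \<open>The first dividing point of a hypotenuse would meet the other tile at
  \<open>(2,3)\<close> or \<open>(2,0)\<close>, and neither is the image of a node under
  \<open>turn\<close>.\<close>

lemma mixed_step: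
  assumes "(v,v2,7) \<in> darts" "v = (1,0) \<and> x = (2,0) \<or> v = (0,2) \<and> x = (2,3)"
    "v' \<in> nodes"
  shows "G (unturn (emb x)) \<noteq> G' (emb v')"
proof
  assume "G (unturn (emb x)) = G' (emb v')"
  moreover have "emb x = (2, of_int (snd x))" using assms(2) by (auto simp: emb_def)
  ultimately have eq: "G (unturn (2, of_int (snd x))) = G' (unturn (emb (turn v')))" by simp
  have "unturn (emb (turn v')) \<in> tri" using nodes_in_tri[OF assms(3)] by simp
  then have "emb (turn v') \<in> etri" by (simp only: unturn_in_tri)
  then have "emb (turn v') = (2, 3 - of_int (snd x))"
    using shared_hyp[OF _ _ eq] assms(2) by auto
  then show False using assms(2,3) by (auto simp: emb_def nodes_def turn_def)
qed

end

context tile_pair begin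

lemma dart_step:
  assumes "i < 5" "j < 5" "(u,w,a) \<in> darts" "(u',w',b) \<in> darts"
    "G (unturn (emb (place i u))) = G' (unturn (emb (place j u')))"
  shows "G (unturn (emb (place i w))) = G' (unturn (emb (place j w'))) \<longleftrightarrow>
    8 dvd (shift i - \<psi> + a) - (shift j - \<psi>' + b)" (is "?L \<longleftrightarrow> ?R")
proof -
  interpret swap: tile_pair G' G \<psi>' \<psi> by (rule swap)
  note n = dart_nodes[OF assms(3)] and n' = dart_nodes[OF assms(4)]
  consider "inner_dart i (u,w,a)" | "inner_dart j (u',w',b)"
    | (outer) "\<not> inner_dart i (u,w,a)" "\<not> inner_dart j (u',w',b)" by blast
  then show ?thesis
  proof cases
    case 1
    then show ?thesis using inner_dart_step[OF assms(1-4) _ assms(5)] by blast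
  next
    case 2
    have "8 dvd (shift j - \<psi>' + b) - (shift i - \<psi> + a) \<longleftrightarrow> ?R" by (rule dvd_diff_commute)
    then show ?thesis using swap.inner_dart_step[OF assms(2,1,4,3) 2 assms(5)[symmetric]] by metis
  next
    case outer
    from shared_point[OF assms(1) n(1) assms(5) place_in_etri[OF assms(2) n'(1)]] show ?thesis
    proof (elim disjE bexE conjE)
      fix v v' assume v: "v \<in> nodes" "v' \<in> nodes" "place i u = turn v" "emb (place j u') = emb (turn v')" "G (emb v) = G' (emb v')"
      obtain v2 c where c: "(v,v2,c) \<in> darts" "8 dvd (shift i + a) + c"
        "if c = 7 then v = (1,0) \<and> place i w = (2,0) \<or> v = (0,2) \<and> place i w = (2,3) else place i w = turn v2"
        using outer_dart_at_node[OF assms(1,3) v(1,3) outer(1)] .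
      have "place j u' = turn v'" using v(4) by simp
      then obtain v2' c' where c': "(v',v2',c') \<in> darts" "8 dvd (shift j + b) + c'"
        "if c' = 7 then v' = (1,0) \<and> place j w' = (2,0) \<or> v' = (0,2) \<and> place j w' = (2,3) else place j w' = turn v2'"
        by (rule outer_dart_at_node[OF assms(2,4) v(2) _ outer(2)])
      have IH: "G (emb v2) = G' (emb v2') \<longleftrightarrow> 8 dvd (\<psi> + c) - (\<psi>' + c')"
        using compatible_dart[OF comp c(1) c'(1)] v(5) by simp
      have e: "(shift i - \<psi> + a) - (shift j - \<psi>' + b) = - ((\<psi> + c) - (\<psi>' + c')) + ((shift i + a + c) - (shift j + b + c'))"
        by simp
      have R: "?R \<longleftrightarrow> 8 dvd (\<psi> + c) - (\<psi>' + c')"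
        unfolding e using dvd_diff[OF c(2) c'(2)] by (simp only: dvd_add_left_iff dvd_minus_iff)
      have type: "c = 7 \<longleftrightarrow> c' = 7" if "G (emb v2) = G' (emb v2')"
        using dart_type[OF c(1) c'(1) v(5) that] .
      have "?L \<longleftrightarrow> G (emb v2) = G' (emb v2')"
      proof (cases "c = 7"; cases "c' = 7")
        assume 77: "c = 7" "c' = 7"
        have "unturn (emb (place i w)) = (1 - 1/5) *\<^sub>R emb v + (1/5) *\<^sub>R emb v2"
          using fifth_point[OF c(1)] 77 c(3) by simp
        moreover have "unturn (emb (place j w')) = (1 - 1/5) *\<^sub>R emb v' + (1/5) *\<^sub>R emb v2'"
          using fifth_point[OF c'(1)] 77 c'(3) by simp
        ultimately show ?thesis
          by (simp only: affine_mapD[OF affine(1)] affine_mapD[OF affine(2)] v(5)) simp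
      next
        assume *: "c = 7" "c' \<noteq> 7"
        then have "\<not> ?L" using mixed_step[of v v2 "place i w" v2'] c c' dart_nodes(2)[OF c'(1)] by simp
        then show ?thesis using type * by blast
      next
        assume *: "c \<noteq> 7" "c' = 7"
        then have "\<not> ?L" using swap.mixed_step[of v' v2' "place j w'" v2] c c' dart_nodes(2)[OF c(1)] by fastforce
        then show ?thesis using type * by blast
      next
        assume "c \<noteq> 7" "c' \<noteq> 7"
        then show ?thesis using c c' by simp
      qed
      then show ?thesis using IH R by blast
    next
      fix y :: int assume y: "y \<in> {0,1,2,3}" "place i u = (2, y)" "emb (place j u') = emb (2, 3 - y)"
        "8 dvd \<psi> - \<psi>'" "G (1,0) = G' (0,2)" "G (0,2) = G' (1,0)"
      have y': "place j u' = (2, 3 - y)" using y(3) by simp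
      have no: "\<not> old_dart i (u,w,a)" "\<not> old_dart j (u',w',b)"
        using y(1,2) y' by (auto simp: old_dart_def darts_def turn_def)
      then have h: "hyp_dart i (u,w,a)" "hyp_dart j (u',w',b)"
        using child_dart_cases assms(1-4) outer by blast+
      define l l' where "l = snd (place i w)" "l' = snd (place j w')"
      then have l: "place i w = (2,l)" "place j w' = (2,l')" using h by (simp_all add: hyp_dart_def prod_eq_iff)
      have k: "\<bar>y - l\<bar> = 1" "(shift i + a) mod 8 = (if even (min y l) then 5 else 1)"
        "\<bar>3 - y - l'\<bar> = 1" "(shift j + b) mod 8 = (if even (min (3 - y) l') then 5 else 1)"
        using h by (simp_all add: hyp_dart_def l y y')
      have "G (unturn (emb (place i w))) = G' (unturn (2, 3 - of_int l))"
        using mirror[OF y(5,6), of "of_int l"] by (simp add: l emb_def)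
      also have "\<dots> = G' (unturn (emb (place j w'))) \<longleftrightarrow> 3 - l = l'"
        using inj(2) inj_unturn by (auto simp: l emb_def inj_eq)
      finally have L: "?L \<longleftrightarrow> 3 - l = l'" .
      have e: "(shift i - \<psi> + a) - (shift j - \<psi>' + b) = - (\<psi> - \<psi>') + ((shift i + a) - (shift j + b))" by simp
      have "?R \<longleftrightarrow> 8 dvd (shift i + a) - (shift j + b)"
        unfolding e using y(4) by (simp only: dvd_add_right_iff dvd_minus_iff)
      also have "\<dots> \<longleftrightarrow> (even (min y l) \<longleftrightarrow> even (min (3 - y) l'))"
        unfolding mod_eq_dvd_iff[symmetric] k(2,4) by simp
      also have "\<dots> \<longleftrightarrow> 3 - l = l'"
      proof -
        have "l = y + 1 \<or> l = y - 1" "l' = 4 - y \<or> l' = 2 - y" using k(1,3) by linarith+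
        then show ?thesis by (elim disjE) (simp_all add: min_def)
      qed
      finally show ?thesis using L by simp
    qed
  qed
qed

lemma compatible_children:
  assumes "i < 5" "j < 5"
  shows "compatible (child i (G,\<psi>)) (child j (G',\<psi>'))"
proof -
  have f: "fst (child i (G,\<psi>)) z = G (unturn (place i z))" "fst (child j (G',\<psi>')) z = G' (unturn (place j z))" for z
    by (simp_all add: child_def)
  have g: "snd (child i (G,\<psi>)) = shift i - \<psi>" "snd (child j (G',\<psi>')) = shift j - \<psi>'"
    by (simp_all add: child_def)
  show ?thesis
    unfolding compatible_def f g emb_place[symmetric]
  proof (intro conjI ballI impI; (clarify)?)
    fix z y assume "z \<in> tri_interior" "G (unturn (place i z)) = G' (unturn (place j y))" "y \<in> tri"
    then have False using not_interior place_tri_interior_subset place_tri_subset assms by blast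
    then show "child i (G,\<psi>) = child j (G',\<psi>')" ..
  next
    fix u1 u2 w1 w2 a z1 z2 y1 y2
    assume "((u1,u2),(w1,w2),a) \<in> darts" "(z1,z2) \<in> open_segment (emb (u1,u2)) (emb (w1,w2))"
      "G (unturn (place i (z1,z2))) = G' (unturn (place j (y1,y2)))" "(y1,y2) \<in> tri"
    from edge_step[OF assms this(1,2,4,3)]
    show "\<exists>(u',w',b)\<in>darts. G (unturn (emb (place i (u1,u2)))) = G' (unturn (emb (place j u'))) \<and>
       G (unturn (emb (place i (w1,w2)))) = G' (unturn (emb (place j w'))) \<and> (a = 7 \<longleftrightarrow> b = 7)"
      by blast
  qed (use node_step octants_step dart_step assms in \<open>blast+\<close>)
qed

end

definition affine_inj :: "ltile \<Rightarrow> bool" where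
  "affine_inj s \<longleftrightarrow> affine_map (fst s) \<and> inj (fst s)"

lemma affine_inj_level: "s \<in> level n \<Longrightarrow> affine_inj s"
proof (induction n arbitrary: s)
  case 0
  then show ?case by (simp add: affine_inj_def affine_map_def id_def inj_def)
next
  case (Suc n)
  then obtain i r where r: "s = child i r" "r \<in> level n" by auto
  then have "affine_map (fst r)" "inj (fst r)" using Suc.IH by (auto simp: affine_inj_def)
  then show ?case unfolding r(1) affine_inj_def child_def fst_conv
    by (intro conjI affine_map_comp affine_unturn affine_place inj_compose inj_unturn inj_place)
qed

lemma child_level: "r \<in> level n \<Longrightarrow> i < 5 \<Longrightarrow> child i r \<in> level (Suc n)"
  unfolding level.simps by blast

lemma tile_pair_level:
  assumes "compatible s t" "compatible t s" "s \<in> level n" "t \<in> level n" "s \<noteq> t"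
  shows "tile_pair (fst s) (fst t) (snd s) (snd t)"
  using assms affine_inj_level[of s n] affine_inj_level[of t n]
  by unfold_locales (auto simp: affine_inj_def prod_eq_iff)

lemma fst_child: "fst (child i s) z = fst s (unturn (place i z))"
  by (simp add: child_def)

lemma snd_child: "snd (child i s) = shift i - snd s"
  by (simp add: child_def)

lemma compatible_siblings:
  assumes "affine_inj s" "i < 5" "j < 5"
  shows "compatible (child i s) (child j s)"
proof -
  have eq: "fst s (unturn x) = fst s (unturn y) \<longleftrightarrow> x = y" for x y
    using assms(1) inj_unturn by (auto simp: affine_inj_def inj_eq)
  have e: "x - snd s + a - (y - snd s + b) = (x + a) - (y + b)" for x y a b by simp
  show ?thesis
    unfolding compatible_def fst_child snd_child emb_place[symmetric] eq image_iff e emb_eq_iff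
  proof (intro conjI)
    show "\<forall>z\<in>tri_interior. (\<exists>x\<in>tri. place i z = place j x) \<longrightarrow> child i s = child j s"
      using place_interior_disjoint assms(2,3) by blast
    show "\<forall>(u,w,a)\<in>darts. \<forall>z\<in>open_segment (emb u) (emb w).
      (\<exists>x\<in>tri. place i z = place j x) \<longrightarrow>
      (\<exists>(u',w',b)\<in>darts. place i u = place j u' \<and> place i w = place j w' \<and> (a = 7 \<longleftrightarrow> b = 7))"
    proof (intro ballI, unfold split_beta, intro ballI impI)
      fix d z assume d: "d \<in> darts" "z \<in> open_segment (emb (fst d)) (emb (fst (snd d)))"
        "\<exists>x\<in>tri. place i z = place j x"
      then obtain y where "y \<in> tri" "place i z = place j y" by blast
      moreover have "place i z \<in> open_segment (emb (place i (fst d))) (emb (place i (fst (snd d))))"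
        using affine_open_segment[OF affine_place inj_place] d(2) by (simp add: emb_place)
      ultimately have "\<exists>(u',w',b)\<in>darts. place i (fst d) = place j u' \<and> place i (fst (snd d)) = place j w' \<and>
        (snd (snd d) = 7 \<longleftrightarrow> b = 7)"
        using edge_in_tile[of i "fst d" "fst (snd d)" "snd (snd d)" j y] assms(2,3) d(1) by simp
      then show "\<exists>d'\<in>darts. place i (fst d) = place j (fst d') \<and> place i (fst (snd d)) = place j (fst (snd d')) \<and>
        (snd (snd d) = 7 \<longleftrightarrow> snd (snd d') = 7)"
        by (simp add: split_beta)
    qed
    show "\<forall>u\<in>nodes. (\<exists>x\<in>tri. emb (place i u) = place j x) \<longrightarrow>
        (\<exists>v\<in>nodes. place i u = place j v)"
      using point_in_tile assms(2,3) by blast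
    show "\<forall>(u,a)\<in>octants. \<forall>(v,b)\<in>octants. place i u = place j v \<and> 8 dvd (shift i + a) - (shift j + b) \<longrightarrow>
       child i s = child j s"
      using child_octants_disjoint assms(2,3) by blast
    show "\<forall>(u,w,a)\<in>darts. \<forall>(u',w',b)\<in>darts. place i u = place j u' \<longrightarrow>
       (place i w = place j w' \<longleftrightarrow> 8 dvd (shift i + a) - (shift j + b))"
      using child_darts_consistent assms(2,3) by blast
  qed
qed

lemma compatible_root: "compatible (id,0) (id,0)"
  unfolding compatible_def
proof (intro conjI)
  show "\<forall>(u,w,a)\<in>darts. \<forall>z\<in>open_segment (emb u) (emb w). fst (id,0::int) z \<in> fst (id,0::int) ` tri \<longrightarrow>
    (\<exists>(u',w',b)\<in>darts. fst (id,0::int) (emb u) = fst (id,0::int) (emb u') \<and> fst (id,0::int) (emb w) = fst (id,0::int) (emb w') \<and> (a = 7 \<longleftrightarrow> b = 7))"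
    by (simp only: fst_conv id_apply emb_eq_iff) blast
  show "\<forall>(u,w,a)\<in>darts. \<forall>(u',w',b)\<in>darts. fst (id,0::int) (emb u) = fst (id,0::int) (emb u') \<longrightarrow>
    (fst (id,0::int) (emb w) = fst (id,0::int) (emb w') \<longleftrightarrow> 8 dvd (snd (id::plane\<Rightarrow>plane,0::int) + a) - (snd (id::plane\<Rightarrow>plane,0) + b))"
    using darts_octants_root(2) by (simp only: fst_conv snd_conv id_apply emb_eq_iff add_0)
qed auto

lemma level_compatible: "s \<in> level n \<Longrightarrow> t \<in> level n \<Longrightarrow> compatible s t"
proof (induction n arbitrary: s t)
  case 0
  then show ?case using compatible_root by simp
next
  case (Suc n)
  then obtain i j s0 t0 where s: "i < 5" "s = child i s0" "s0 \<in> level n" and t: "j < 5" "t = child j t0" "t0 \<in> level n"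
    by auto
  show ?case
  proof (cases "s0 = t0")
    case True
    then show ?thesis using compatible_siblings affine_inj_level s t by blast
  next
    case False
    then interpret tile_pair "fst s0" "fst t0" "snd s0" "snd t0"
      using tile_pair_level Suc.IH s(3) t(3) by blast
    show ?thesis using compatible_children s t by simp
  qed
qed

lemma tile_pair_levelI: "s \<in> level n \<Longrightarrow> t \<in> level n \<Longrightarrow> s \<noteq> t \<Longrightarrow> tile_pair (fst s) (fst t) (snd s) (snd t)"
  using tile_pair_level level_compatible by blast

text \<open>The only 2-legs with an unoccupied midpoint on both sides are those shared by the second and
  the fourth tile of a dissection.\<close>

lemma shared_midpoint:
  assumes "s \<in> level n" "t \<in> level n" "s \<noteq> t" "fst s (emb (0,1)) = fst t (emb (0,1))"
  obtains m r where "n = Suc m" "r \<in> level m" "s = child 1 r \<or> s = child 3 r"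
proof (cases n)
  case 0
  then show thesis using assms by simp
next
  case (Suc m)
  then obtain i j s0 t0 where s: "i < 5" "s = child i s0" "s0 \<in> level m" and t: "j < 5" "t = child j t0" "t0 \<in> level m"
    using assms by auto
  have n: "(0,1) \<in> nodes" by (simp add: nodes_def)
  have eq: "fst s0 (unturn (emb (place i (0,1)))) = fst t0 (unturn (emb (place j (0,1))))"
    using assms(4) unfolding s(2) t(2) fst_child by (simp add: emb_place)
  have "i = 1 \<or> i = 3"
  proof (cases "s0 = t0")
    case True
    then have "place i (0,1) = (place j (0,1) :: int \<times> int)"
      using eq affine_inj_level[OF s(3)] inj_unturn by (simp add: affine_inj_def inj_eq)
    moreover have "i \<noteq> j" using True assms(3) s t by auto
    ultimately show ?thesis using s(1) t(1) unfolding lt5 by (elim disjE) (simp_all add: place_simps)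
  next
    case False
    then interpret tile_pair "fst s0" "fst t0" "snd s0" "snd t0"
      using tile_pair_levelI s(3) t(3) by blast
    from shared_point[OF s(1) n eq place_in_etri[OF t(1) n]] show ?thesis
      using s(1) t(1) unfolding lt5 by (elim disjE) (auto simp: place_simps nodes_def turn_def)
  qed
  then show thesis using that[OF Suc s(3)] s(2) by blast
qed

lemma inner_point_unique:
  assumes "s \<in> level n" "t \<in> level n" "fst s (unturn z) = fst t (unturn z')" "z \<in> etri_interior" "z' \<in> etri"
  shows "s = t"
proof (rule ccontr)
  assume "s \<noteq> t"
  then interpret tile_pair "fst s" "fst t" "snd s" "snd t" using tile_pair_levelI assms by blast
  show False using not_interior assms by blast
qed

definition free_end :: "ltile \<Rightarrow> plane" where "free_end r = fst r (unturn (1, 0))"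
definition far_end :: "ltile \<Rightarrow> plane" where "far_end r = fst r (unturn (1, 2))"
definition leg_mid :: "ltile \<Rightarrow> plane" where "leg_mid r = fst r (unturn (1, 1))"

lemma far_end_eq: "far_end r = fst r (emb (0,1))"
  by (simp add: far_end_def emb_def unturn_def)

lemma long_leg_child:
  "fst (child 1 r) (emb (0,0)) = free_end r" "fst (child 1 r) (emb (0,2)) = far_end r"
  "fst (child 1 r) (emb (0,1)) = leg_mid r"
  "fst (child 3 r) (emb (0,0)) = far_end r" "fst (child 3 r) (emb (0,2)) = free_end r"
  "fst (child 3 r) (emb (0,1)) = leg_mid r"
  unfolding fst_child free_end_def far_end_def leg_mid_def by (simp_all add: emb_def place_simps)

lemma free_end_etri: "(1, 0) \<in> etri_interior" "(1, 2) \<in> etri" "(1, 0) \<in> etri"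
  by (simp_all add: etri_interior_def etri_def)

lemma free_end_neq:
  assumes "r \<in> level m" "r' \<in> level m" "r \<noteq> r'"
  shows "free_end r \<noteq> free_end r'" "free_end r \<noteq> far_end r'"
  using inner_point_unique[OF assms(1,2)] assms(3) free_end_etri unfolding free_end_def far_end_def by blast+

lemma far_end_colour:
  assumes "r \<in> level m" "r' \<in> level m" "far_end r = far_end r'" "8 dvd (5 - snd r) - (5 - snd r')"
  shows "r = r'"
proof -
  have o: "((0,1),2) \<in> octants" by (simp add: octants_def)
  have "8 dvd (snd r + 2) - (snd r' + 2)" by (rule dvd_neg_eq[OF assms(4)]) simp
  then show ?thesis using compatible_octant[OF level_compatible[OF assms(1,2)] o o] assms(3)
    by (simp add: far_end_eq)
qed

lemma no_free_end_dart:
  "\<forall>i<5. \<forall>(u,w,a)\<in>darts. place i u = (1,0) \<longrightarrow> \<not> 8 dvd (shift i + a - 5)"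
  unfolding darts_def nodes_def all_less5 ball_simps prod.case
  by (simp add: place_simps shift_simps)

lemma far_end_dart:
  assumes "r \<in> level m" "t \<in> level (Suc m)" "(u,w,a) \<in> darts" "fst t (emb u) = free_end r \<or> fst t (emb u) = far_end r"
    "8 dvd (snd t + a) - (5 - snd r)"
  shows "fst t (emb u) = far_end r" "fst t (emb w) = leg_mid r"
proof -
  obtain j t0 where t: "j < 5" "t = child j t0" "t0 \<in> level m" using assms(2) by auto
  show 1: "fst t (emb u) = far_end r"
  proof (rule ccontr)
    assume "\<not> ?thesis"
    then have e: "fst t0 (unturn (emb (place j u))) = fst r (unturn (1,0))"
      using assms(4) unfolding t(2) fst_child free_end_def by (simp add: emb_place)
    have "emb (place j u) \<in> etri" using place_in_etri t(1) dart_nodes(1)[OF assms(3)] by blast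
    then have [simp]: "t0 = r" using inner_point_unique[OF assms(1) t(3) e[symmetric]] free_end_etri by simp
    have "emb (place j u) = emb (1,0)"
      using e affine_inj_level[OF assms(1)] inj_unturn by (simp add: affine_inj_def inj_eq emb_def)
    then have "place j u = (1,0)" by simp
    then have "\<not> 8 dvd (shift j + a - 5)" using no_free_end_dart t(1) assms(3) by blast
    moreover have e: "(snd t + a) - (5 - snd r) = shift j + a - 5" unfolding t(2) snd_child by simp
    have "8 dvd (shift j + a - 5)" using assms(5) unfolding e .
    ultimately show False by blast
  qed
  have d: "((0,2),(0,1),6) \<in> darts" by (simp add: darts_def)
  have c: "child 1 r \<in> level (Suc m)" using assms(1) by (intro child_level) simp_all
  have "8 dvd (snd t + a) - (snd (child 1 r) + 6)"
    using dvd_diff[OF assms(5) dvd_refl] by (simp add: snd_child shift_def algebra_simps)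
  then show "fst t (emb w) = leg_mid r"
    using compatible_dart[OF level_compatible[OF assms(2) c] assms(3) d] 1 by (simp only: long_leg_child)
qed

declare split_paired_All [simp del] split_paired_Ex [simp del]

section \<open>Supertiles as sets of tiles\<close>

lemma affine_map_linear:
  assumes "affine_map G" shows "linear (\<lambda>x. G x - G 0)"
proof -
  have scale: "G (c *\<^sub>R x) - G 0 = c *\<^sub>R (G x - G 0)" for c x
    using affine_mapD[OF assms, of c 0 x] by (simp add: algebra_simps)
  have "G (x + y) - G 0 = (G x - G 0) + (G y - G 0)" for x y
  proof -
    have "G (x + y) = (1 - 1/2) *\<^sub>R G (2 *\<^sub>R x) + (1/2) *\<^sub>R G (2 *\<^sub>R y)"
      using affine_mapD[OF assms, of "1/2" "2 *\<^sub>R x" "2 *\<^sub>R y"] by simp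
    moreover have "G (2 *\<^sub>R x) = 2 *\<^sub>R (G x - G 0) + G 0" "G (2 *\<^sub>R y) = 2 *\<^sub>R (G y - G 0) + G 0"
      using scale[of 2 x] scale[of 2 y] by (simp_all add: algebra_simps)
    moreover have "(1/2) *\<^sub>R G 0 + (1/2) *\<^sub>R G 0 = G 0" by (simp flip: scaleR_add_left)
    ultimately show ?thesis by (simp add: algebra_simps)
  qed
  then show ?thesis using scale by (intro linearI) auto
qed

lemma affine_map_image:
  "G ` S = (+) (G 0) ` (\<lambda>x. G x - G 0) ` S" for G :: "plane \<Rightarrow> plane"
  by (simp add: image_image)

lemma affine_convex_hull:
  assumes "affine_map G" shows "G ` (convex hull S) = convex hull (G ` S)"
  using convex_hull_linear_image[OF affine_map_linear[OF assms]] convex_hull_translation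
  by (metis affine_map_image)

lemma affine_interior:
  assumes "affine_map G" "inj G" shows "interior (G ` S) = G ` interior S"
proof -
  have "inj (\<lambda>x. G x - G 0)" using assms(2) by (simp add: inj_def)
  then show ?thesis
    using interior_injective_linear_image[OF affine_map_linear[OF assms(1)]] interior_translation
    by (metis affine_map_image)
qed

lemma affine_continuous: "affine_map G \<Longrightarrow> continuous_on S G"
  using linear_continuous_on[OF linear_conv_bounded_linear[THEN iffD1], OF affine_map_linear, of G S]
    continuous_on_add[OF continuous_on_const[of S "G 0"], of "\<lambda>x. G x - G 0"] by simp

lemma affine_extreme_point:
  assumes "affine_map G" "inj G"
  shows "v extreme_point_of (G ` S) \<longleftrightarrow> (\<exists>x. v = G x \<and> x extreme_point_of S)"
proof -
  have "(\<forall>a\<in>G ` S. \<forall>b\<in>G ` S. G x \<notin> open_segment a b) \<longleftrightarrow> (\<forall>a\<in>S. \<forall>b\<in>S. x \<notin> open_segment a b)" for x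
    by (simp add: affine_open_segment[OF assms])
  then show ?thesis unfolding extreme_point_of_def by blast
qed

lemma isometry_affine:
  assumes "isometry f" shows "affine_map f" "inj f"
proof -
  have "orthogonal_transformation (\<lambda>x. f x - f 0)"
    using assms unfolding orthogonal_transformation_isometry isometry_def by (simp add: dist_norm)
  then have l: "linear (\<lambda>x. f x - f 0)" by (rule orthogonal_transformation_linear)
  have "f ((1 - t) *\<^sub>R x + t *\<^sub>R y) - f 0 = (1 - t) *\<^sub>R (f x - f 0) + t *\<^sub>R (f y - f 0)" for x y t
    using linear_add[OF l, of "(1 - t) *\<^sub>R x" "t *\<^sub>R y"] linear_cmul[OF l, of "1 - t" x] linear_cmul[OF l, of t y] by simp
  then have "f ((1 - t) *\<^sub>R x + t *\<^sub>R y) = (1 - t) *\<^sub>R f x + t *\<^sub>R f y" for x y t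
    by (simp add: algebra_simps)
  then show "affine_map f" unfolding affine_map_def by blast
  show "inj f" using assms unfolding isometry_def inj_def by (metis dist_eq_0_iff)
qed

lemma isometryD: "isometry f \<Longrightarrow> dist (f x) (f y) = dist x y"
  by (simp add: isometry_def)

lemma tri_halfspaces: "tri = {z. (-1,0) \<bullet> z \<le> 0} \<inter> {z. (0,-1) \<bullet> z \<le> 0} \<inter> {z. (2,1) \<bullet> z \<le> 2}"
  by (auto simp: tri_def inner_prod_def)

lemma convex_tri: "convex tri"
  unfolding tri_halfspaces by (intro convex_Int convex_halfspace_le)

lemma prototile_eq: "prototile = tri"
proof
  show "prototile \<subseteq> tri" unfolding prototile_def
    by (intro hull_minimal convex_tri) (auto simp: tri_def)
  show "tri \<subseteq> prototile"
  proof
    fix z assume z: "z \<in> tri"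
    have "z = (1 - fst z - snd z / 2) *\<^sub>R (0,0) + fst z *\<^sub>R (1,0) + (snd z / 2) *\<^sub>R (0,2)"
      by (simp add: prod_eq_iff)
    moreover have "0 \<le> 1 - fst z - snd z / 2" "0 \<le> fst z" "0 \<le> snd z / 2" using z by (auto simp: tri_def)
    ultimately show "z \<in> prototile" unfolding prototile_def convex_hull_3 by fastforce
  qed
qed

lemma interior_tri: "interior tri = tri_interior"
proof -
  have "(-1,0) \<noteq> (0::plane)" "(0,-1) \<noteq> (0::plane)" "(2,1) \<noteq> (0::plane)" by (simp_all add: prod_eq_iff)
  then show ?thesis
    unfolding tri_halfspaces interior_Int by (simp only: interior_halfspace_le not_False_eq_True)
      (auto simp: tri_interior_def inner_prod_def)
qed

lemma closed_tri: "closed tri"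
  unfolding tri_halfspaces by (intro closed_Int closed_halfspace_le)

lemma bounded_tri: "bounded tri"
  unfolding prototile_eq[symmetric] prototile_def by (intro bounded_convex_hull) simp

lemma closure_tri_interior: "closure tri_interior = tri"
proof -
  have "tri_interior \<noteq> {}" by (auto simp: tri_interior_def intro!: exI[of _ "(1/4, 1/4)"])
  then show ?thesis using convex_closure_interior[OF convex_tri] closed_tri by (simp add: interior_tri)
qed

lemma extreme_point_tri: "v extreme_point_of tri \<longleftrightarrow> v \<in> {(0,0), (1,0), (0,2)}"
proof
  assume "v extreme_point_of tri"
  then show "v \<in> {(0,0), (1,0), (0,2)}"
    unfolding prototile_eq[symmetric] prototile_def by (rule extreme_point_of_convex_hull)
next
  have pos: "p = 0 \<and> q = 0" if "0 \<le> p" "0 \<le> q" "(1 - t) * p + t * q = 0" "0 < t" "t < 1" for p q t :: real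
  proof -
    have "0 \<le> (1 - t) * p" "0 \<le> t * q" using that by auto
    then have "(1 - t) * p = 0" "t * q = 0" using that(3) by linarith+
    then show ?thesis using that by auto
  qed
  assume v: "v \<in> {(0,0), (1,0), (0,2)}"
  show "v extreme_point_of tri" unfolding extreme_point_of_def
  proof (intro conjI ballI notI)
    show "v \<in> tri" using v by (auto simp: tri_def)
    fix a b assume ab: "a \<in> tri" "b \<in> tri" "v \<in> open_segment a b"
    then obtain t where t: "a \<noteq> b" "0 < t" "t < 1" "v = (1 - t) *\<^sub>R a + t *\<^sub>R b" unfolding in_segment by blast
    then have c: "fst v = (1 - t) * fst a + t * fst b" "snd v = (1 - t) * snd a + t * snd b" by simp_all
    have 1: "0 \<le> fst a" "0 \<le> snd a" "0 \<le> 2 - 2 * fst a - snd a" "0 \<le> fst b" "0 \<le> snd b" "0 \<le> 2 - 2 * fst b - snd b"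
      using ab by (auto simp: tri_def)
    have x: "fst v = 0 \<Longrightarrow> fst a = 0 \<and> fst b = 0" using pos[OF 1(1,4) _ t(2,3)] c by simp
    have y: "snd v = 0 \<Longrightarrow> snd a = 0 \<and> snd b = 0" using pos[OF 1(2,5) _ t(2,3)] c by simp
    have w: "2 - 2 * fst v - snd v = 0 \<Longrightarrow> 2 - 2 * fst a - snd a = 0 \<and> 2 - 2 * fst b - snd b = 0"
      using pos[OF 1(3,6) _ t(2,3)] unfolding c by (simp add: algebra_simps)
    have "a = b" using v x y w by (auto simp: prod_eq_iff)
    then show False using t(1) by simp
  qed
qed

lemma affine_turn: "affine_map turn"
  by (simp add: affine_map_def turn_def prod_eq_iff algebra_simps)

lemma expanded_tile_eq: "expanded_tile = turn ` prototile"
  unfolding expanded_tile_def prototile_def affine_convex_hull[OF affine_turn] by (simp add: turn_def)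

lemma unturn_expanded: "unturn ` expanded_tile = prototile"
  by (simp add: expanded_tile_eq image_image)

lemma dissection_eq: "dissection = (\<lambda>i. place i ` prototile) ` {..<5}"
proof -
  have e: "{..<5::nat} = {0,1,2,3,4}" by auto
  have "place i ` prototile = convex hull {place i (0,0), place i (1,0), place i (0,2)}" for i
    unfolding prototile_def affine_convex_hull[OF affine_place] by simp
  then show ?thesis unfolding dissection_def e
    by (simp add: place_simps) (auto simp: insert_commute)
qed

lemma dist_turn: "dist (turn x) (turn y) = sqrt 5 * dist x y" for x y :: plane
proof -
  have "(dist (turn x) (turn y))\<^sup>2 = (sqrt 5 * dist x y)\<^sup>2"
    by (simp add: dist_prod_def dist_real_def turn_def power_mult_distrib) (simp add: power2_eq_square algebra_simps)
  then show ?thesis by (simp add: power2_eq_iff_nonneg)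
qed

lemma isometry_expanded_unique:
  assumes "isometry f" "isometry g" "f ` expanded_tile = g ` expanded_tile"
  shows "f = g"
proof -
  note f = isometry_affine[OF assms(1)] and g = isometry_affine[OF assms(2)]
  have e: "h ` expanded_tile = (h \<circ> turn) ` tri" for h :: "plane \<Rightarrow> plane"
    by (simp add: expanded_tile_eq prototile_eq image_comp)
  have it: "inj (turn :: plane \<Rightarrow> plane)" by (metis injI unturn_turn)
  have ext: "{v. v extreme_point_of (h ` expanded_tile)} = {h (0,0), h (2,-1), h (2,4)}"
    if "affine_map h" "inj h" for h
    unfolding e affine_extreme_point[OF affine_map_comp[OF that(1) affine_turn] inj_compose[OF that(2) it]] extreme_point_tri
    by (force simp: turn_def)
  have S: "{f (0,0), f (2,-1), f (2,4)} = {g (0,0), g (2,-1), g (2,4)}"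
    using ext[OF f] ext[OF g] assms(3) by simp
  have d: "dist (h (0,0)) (h (2,-1)) = sqrt 5" "dist (h (0,0)) (h (2,4)) = sqrt 20" "dist (h (2,-1)) (h (2,4)) = 5"
    if "isometry h" for h
    using that unfolding isometry_def by (simp_all add: dist_prod_def dist_real_def)
  have n: "sqrt 5 \<noteq> sqrt 20" "sqrt 5 \<noteq> 5" "sqrt 20 \<noteq> 5" "sqrt 5 \<noteq> 0" "sqrt 20 \<noteq> 0"
    using real_sqrt_eq_iff[of 5 25] real_sqrt_eq_iff[of 20 25] by auto
  have p: "f (0,0) = g (0,0) \<and> f (2,-1) = g (2,-1) \<and> f (2,4) = g (2,4)"
  proof -
    have 1: "f (0,0) \<in> {g (0,0), g (2,-1), g (2,4)}" "f (2,-1) \<in> {g (0,0), g (2,-1), g (2,4)}" "f (2,4) \<in> {g (0,0), g (2,-1), g (2,4)}"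
      using S by blast+
    show ?thesis using 1 d[OF assms(1)] d[OF assms(2)] n
      by (elim insertE emptyE) (simp_all add: dist_commute)
  qed
  show "f = g"
  proof
    fix z :: plane
    have lin: "h z = h (0,0) + ((4 * fst z - 2 * snd z) / 10) *\<^sub>R (h (2,-1) - h (0,0)) + ((fst z + 2 * snd z) / 10) *\<^sub>R (h (2,4) - h (0,0))"
      if "affine_map h" for h
    proof -
      have l: "linear (\<lambda>x. h x - h 0)" by (rule affine_map_linear[OF that])
      have "z = ((4 * fst z - 2 * snd z) / 10) *\<^sub>R (2,-1) + ((fst z + 2 * snd z) / 10) *\<^sub>R (2,4)"
        by (simp add: prod_eq_iff field_simps)
      then have "h z - h 0 = ((4 * fst z - 2 * snd z) / 10) *\<^sub>R (h (2,-1) - h 0) + ((fst z + 2 * snd z) / 10) *\<^sub>R (h (2,4) - h 0)"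
        using linear_add[OF l] linear_cmul[OF l] by metis
      then show ?thesis by (simp add: zero_prod_def algebra_simps)
    qed
    show "f z = g z" unfolding lin[OF f(1)] lin[OF g(1)] using p by simp
  qed
qed

lemma subst_tile_eq:
  assumes "isometry h"
  shows "subst_tile (h ` prototile) = (\<lambda>i. (\<lambda>z. sqrt 5 *\<^sub>R h (unturn (place i z))) ` prototile) ` {..<5}"
proof -
  define f where "f = (\<lambda>z. sqrt 5 *\<^sub>R h (unturn z))"
  have "dist (f x) (f y) = dist x y" for x y
  proof -
    have "dist (f x) (f y) = sqrt 5 * dist (h (unturn x)) (h (unturn y))"
      unfolding f_def dist_norm scaleR_diff_right[symmetric] norm_scaleR by simp
    also have "\<dots> = dist x y" using dist_turn[of "unturn x" "unturn y"] by (simp add: isometryD[OF assms])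
    finally show ?thesis .
  qed
  then have f: "isometry f" by (simp add: isometry_def)
  have fe: "f ` expanded_tile = (\<lambda>x. sqrt 5 *\<^sub>R x) ` h ` prototile"
    by (simp only: f_def unturn_expanded[symmetric] image_image)
  have *: "isometry g \<and> g ` expanded_tile = (\<lambda>x. sqrt 5 *\<^sub>R x) ` h ` prototile \<longleftrightarrow> g = f" for g
  proof
    assume "isometry g \<and> g ` expanded_tile = (\<lambda>x. sqrt 5 *\<^sub>R x) ` h ` prototile"
    then show "g = f" using fe by (intro isometry_expanded_unique f) simp_all
  next
    assume "g = f"
    then show "isometry g \<and> g ` expanded_tile = (\<lambda>x. sqrt 5 *\<^sub>R x) ` h ` prototile" using f fe by simp
  qed
  have "subst_tile (h ` prototile) = {g ` s | g s. (isometry g \<and> g ` expanded_tile = (\<lambda>x. sqrt 5 *\<^sub>R x) ` h ` prototile) \<and> s \<in> dissection}"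
    unfolding subst_tile_def by (simp only: conj_assoc)
  also have "\<dots> = (\<lambda>s. f ` s) ` dissection"
    unfolding * by blast
  also have "\<dots> = (\<lambda>i. (\<lambda>z. sqrt 5 *\<^sub>R h (unturn (place i z))) ` prototile) ` {..<5}"
    unfolding dissection_eq f_def by (simp add: image_image)
  finally show ?thesis .
qed

definition inflate :: "nat \<Rightarrow> plane \<Rightarrow> plane" where "inflate n z = (sqrt 5 ^ n) *\<^sub>R z"

lemma inflate_Suc: "inflate (Suc n) z = sqrt 5 *\<^sub>R inflate n z"
  by (simp add: inflate_def)

lemma dist_place: "dist (place i x) (place i y) = dist x y" for x y :: plane
  by (auto simp: place_def dist_prod_def dist_real_def power2_commute add.commute abs_minus_commute)

lemma isometry_level: "s \<in> level n \<Longrightarrow> isometry (inflate n \<circ> fst s)"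
proof (induction n arbitrary: s)
  case 0
  then show ?case by (simp add: isometry_def inflate_def)
next
  case (Suc n)
  then obtain i r where r: "s = child i r" "r \<in> level n" by auto
  have "dist (inflate (Suc n) (fst s x)) (inflate (Suc n) (fst s y)) = dist x y" for x y
  proof -
    have "dist (inflate (Suc n) (fst s x)) (inflate (Suc n) (fst s y)) =
      sqrt 5 * dist (inflate n (fst s x)) (inflate n (fst s y))"
      unfolding inflate_Suc dist_norm scaleR_diff_right[symmetric] norm_scaleR by simp
    also have "\<dots> = sqrt 5 * dist (unturn (place i x)) (unturn (place i y))"
      using isometryD[OF Suc.IH[OF r(2)]] by (simp add: r(1) child_def)
    also have "\<dots> = dist x y" using dist_turn[of "unturn (place i x)" "unturn (place i y)"] by (simp add: dist_place)
    finally show ?thesis .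
  qed
  then show ?case by (simp add: isometry_def)
qed

lemma supertile_eq: "supertile n = (\<lambda>s. (inflate n \<circ> fst s) ` tri) ` level n"
proof (induction n)
  case 0
  then show ?case by (simp add: supertile_def inflate_def prototile_eq)
next
  case (Suc n)
  have "supertile (Suc n) = (\<Union>s\<in>level n. subst_tile ((inflate n \<circ> fst s) ` tri))"
    using Suc by (simp add: supertile_def pinwheel_subst_def)
  also have "\<dots> = (\<Union>s\<in>level n. \<Union>i<5. {(inflate (Suc n) \<circ> fst (child i s)) ` tri})"
  proof (intro SUP_cong refl)
    fix s assume "s \<in> level n"
    then show "subst_tile ((inflate n \<circ> fst s) ` tri) = (\<Union>i<5. {(inflate (Suc n) \<circ> fst (child i s)) ` tri})"
      using subst_tile_eq[OF isometry_level] by (auto simp: prototile_eq inflate_Suc child_def comp_def)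
  qed
  also have "\<dots> = (\<lambda>s. (inflate (Suc n) \<circ> fst s) ` tri) ` level (Suc n)"
    unfolding level.simps by blast
  finally show ?case .
qed

section \<open>Patches of a tiling inside a supertile\<close>

definition corners :: "(int \<times> int) set" where "corners = {(0,0), (1,0), (0,2)}"

lemma node_not_in_open_edge:
  assumes "(u,w,a) \<in> darts" "v \<in> nodes" shows "emb v \<notin> open_segment (emb u) (emb w)"
  using assms unfolding open_segment_emb darts_def nodes_def
  by (elim insertE emptyE) (auto simp: emb_def)

lemma node_in_long_leg:
  assumes "v \<in> nodes" "emb v \<in> open_segment (emb (0,0)) (emb (0,2))" shows "v = (0,1)"
  using assms unfolding open_segment_emb nodes_def
  by (elim insertE emptyE) (auto simp: emb_def)

lemma side_in_boundary:
  assumes "(u,w,a) \<in> darts \<or> u = (0,0) \<and> w = (0,2) \<or> u = (0,2) \<and> w = (0,0)"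
    "z \<in> closed_segment (emb u) (emb w)"
  shows "z \<in> tri - tri_interior"
proof -
  obtain t where t: "0 \<le> t" "t \<le> 1" "z = (1 - t) *\<^sub>R emb u + t *\<^sub>R emb w"
    using assms(2) unfolding closed_segment_def by blast
  show ?thesis using assms(1) t unfolding darts_def
    by (elim disjE insertE emptyE; simp add: emb_def tri_def tri_interior_def algebra_simps)
qed

locale patch =
  fixes T :: "tile set" and f :: "plane \<Rightarrow> plane" and n :: nat and R :: real
  assumes tiling: "tiling_by_prototile T" and iso: "isometry f"
    and cover: "t \<in> T \<Longrightarrow> t \<inter> ball 0 R \<noteq> {} \<Longrightarrow> \<exists>s\<in>level n. t = (f \<circ> inflate n \<circ> fst s) ` tri"
begin

definition H :: "plane \<Rightarrow> plane" where "H = f \<circ> inflate n"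
definition pos :: "ltile \<Rightarrow> plane \<Rightarrow> plane" where "pos s = H \<circ> fst s"
definition region :: "ltile \<Rightarrow> tile" where "region s = pos s ` tri"

lemma pos_apply: "pos s z = H (fst s z)" by (simp add: pos_def)

lemma H_affine: "affine_map H" "inj H"
proof -
  have "affine_map (inflate n)" by (simp add: affine_map_def inflate_def algebra_simps)
  moreover have "inj (inflate n)" by (simp add: inj_def inflate_def)
  ultimately show "affine_map H" "inj H"
    unfolding H_def using isometry_affine[OF iso] by (simp_all add: affine_map_comp inj_compose)
qed

lemma pos_affine: "s \<in> level n \<Longrightarrow> affine_map (pos s)" "s \<in> level n \<Longrightarrow> inj (pos s)"
  unfolding pos_def using H_affine affine_inj_level[of s n]
  by (simp_all add: affine_inj_def affine_map_comp inj_compose)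

lemma pos_eq: "pos s x = pos t y \<longleftrightarrow> fst s x = fst t y"
  using H_affine(2) by (simp add: pos_def inj_eq)

lemma interior_region: "s \<in> level n \<Longrightarrow> interior (region s) = pos s ` tri_interior"
  unfolding region_def using affine_interior[OF pos_affine] interior_tri by metis

lemma closed_region: "s \<in> level n \<Longrightarrow> closed (region s)"
  unfolding region_def using closed_tri bounded_tri affine_continuous[OF pos_affine(1)]
  by (intro compact_imp_closed compact_continuous_image) (auto simp: compact_eq_bounded_closed)

lemma frontier_region: "s \<in> level n \<Longrightarrow> frontier (region s) = pos s ` (tri - tri_interior)"
  unfolding frontier_def closure_closed[OF closed_region] interior_region
  unfolding region_def using pos_affine(2)[of s] by (simp add: image_set_diff)

lemma closure_interior_region: "s \<in> level n \<Longrightarrow> region s \<subseteq> closure (interior (region s))"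
  unfolding interior_region
  using image_closure_subset[OF affine_continuous[OF pos_affine(1)] closed_closure closure_subset, of s tri_interior]
  by (simp add: region_def closure_tri_interior)

lemma interior_unique:
  assumes "s \<in> level n" "t \<in> level n" "x \<in> interior (region s)" "x \<in> region t" shows "s = t"
proof -
  obtain z z' where "x = pos s z" "z \<in> tri_interior" "x = pos t z'" "z' \<in> tri"
    using assms(3,4) unfolding interior_region[OF assms(1)] unfolding region_def by blast
  then show ?thesis using compatible_interior[OF level_compatible[OF assms(1,2)]] pos_eq by metis
qed

lemma coverD: "t \<in> T \<Longrightarrow> x \<in> t \<Longrightarrow> x \<in> ball 0 R \<Longrightarrow> \<exists>s\<in>level n. t = region s"
  using cover unfolding region_def pos_def H_def by blast

lemma region_in_tiling:
  assumes "s \<in> level n" "x \<in> region s" "x \<in> ball 0 R" shows "region s \<in> T"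
proof -
  have "x \<in> closure (interior (region s))" using closure_interior_region assms by blast
  then obtain y where y: "y \<in> interior (region s)" "y \<in> ball 0 R"
    using open_Int_closure_eq_empty[of "ball 0 R" "interior (region s)"] assms(3) by auto
  obtain t where t: "t \<in> T" "y \<in> t" using tiling unfolding tiling_by_prototile_def by blast
  then obtain s' where s': "s' \<in> level n" "t = region s'" using coverD y by blast
  then have "s = s'" using interior_unique assms(1) y t by blast
  then show ?thesis using s' t by simp
qed

lemma extreme_region: "s \<in> level n \<Longrightarrow> v extreme_point_of region s \<longleftrightarrow> (\<exists>u\<in>corners. v = pos s (emb u))"
  unfolding region_def affine_extreme_point[OF pos_affine] extreme_point_tri by (auto simp: corners_def emb_def)

lemma corner_pointI: "s \<in> level n \<Longrightarrow> region s \<in> T \<Longrightarrow> u \<in> corners \<Longrightarrow> pos s (emb u) \<in> corner_points T"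
  unfolding corner_points_def using extreme_region by blast

lemma corner_is_node:
  assumes "v \<in> corner_points T" "v \<in> ball 0 R" "s \<in> level n" "v \<in> region s"
  obtains u where "u \<in> nodes" "v = pos s (emb u)"
proof -
  obtain t where t: "t \<in> T" "v extreme_point_of t" using assms(1) by (auto simp: corner_points_def)
  then have "v \<in> t" by (simp add: extreme_point_of_def)
  then obtain s' where s': "s' \<in> level n" "t = region s'" using coverD t(1) assms(2) by blast
  then obtain u where u: "u \<in> corners" "v = pos s' (emb u)" using t(2) extreme_region by blast
  have "u \<in> nodes" using u by (auto simp: corners_def nodes_def)
  moreover obtain z where "z \<in> tri" "v = pos s z" using assms(4) by (auto simp: region_def)
  ultimately obtain w where "w \<in> nodes" "fst s' (emb u) = fst s (emb w)"
    using compatible_node[OF level_compatible[OF s'(1) assms(3)]] u(2) pos_eq by metis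
  then show thesis using that u(2) pos_eq by metis
qed

lemma other_tile:
  assumes "t \<in> T" "x \<in> ball 0 R" "x \<notin> interior t" shows "\<exists>t'\<in>T. t' \<noteq> t \<and> x \<in> t'"
proof (rule ccontr)
  assume none: "\<not> ?thesis"
  define P where "P = {t'\<in>T. t' \<inter> ball 0 R \<noteq> {}} - {t}"
  have sub: "P \<subseteq> region ` level n" using coverD unfolding P_def by blast
  have "finite (level n)" by (induction n) (simp_all add: finite_image_set2)
  then have "finite P" using sub by (meson finite_imageI finite_subset)
  moreover have "closed t'" if "t' \<in> P" for t' using that sub closed_region by blast
  ultimately have "closed (\<Union>P)" by (intro closed_Union) auto
  then have o: "open (ball 0 R - \<Union>P)" by (simp add: open_Diff)
  have x: "x \<in> ball 0 R - \<Union>P" using none assms(2) unfolding P_def by blast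
  have "ball 0 R - \<Union>P \<subseteq> t"
  proof
    fix y assume y: "y \<in> ball 0 R - \<Union>P"
    obtain t' where "t' \<in> T" "y \<in> t'" using tiling unfolding tiling_by_prototile_def by blast
    then show "y \<in> t" using y unfolding P_def by blast
  qed
  then show False using assms(3) o x interiorI by blast
qed

definition edge_colour :: "plane set \<Rightarrow> int \<Rightarrow> bool" where
  "edge_colour e k \<longleftrightarrow>
    (\<exists>s\<in>level n. \<exists>(u,w,a)\<in>darts. e = {pos s (emb u), pos s (emb w)} \<and> k = (snd s + a) mod 8) \<or>
    (\<exists>m. \<exists>r\<in>level m. n = Suc m \<and> e = {H (free_end r), H (far_end r)} \<and> k = (5 - snd r) mod 8)"

lemma edge_coloured:
  assumes "e \<in> corner_edges T" "e \<subseteq> ball 0 R" shows "\<exists>k. edge_colour e k"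
proof -
  obtain p q t where e: "e = {p,q}" "p \<in> corner_points T" "q \<in> corner_points T" "p \<noteq> q" "t \<in> T"
    "closed_segment p q \<subseteq> frontier t" "open_segment p q \<inter> corner_points T = {}"
    using assms(1) unfolding corner_edges_def by blast
  have b: "p \<in> ball 0 R" "q \<in> ball 0 R" using assms(2) e(1) by auto
  have "closed t"
  proof -
    obtain g where "isometry g" "t = g ` tri"
      using tiling e(5) unfolding tiling_by_prototile_def prototile_eq by blast
    then show ?thesis using closed_tri bounded_tri affine_continuous[OF isometry_affine(1)]
      by (auto intro!: compact_imp_closed compact_continuous_image simp: compact_eq_bounded_closed)
  qed
  then have ft: "frontier t \<subseteq> t" by (simp add: frontier_subset_closed)
  then have "p \<in> t" "q \<in> t" using e(6) by auto
  then obtain s where s: "s \<in> level n" "t = region s" using coverD e(5) b by blast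
  obtain u where u: "u \<in> nodes" "p = pos s (emb u)" using corner_is_node[OF e(2) b(1) s(1)] \<open>p \<in> t\<close> s(2) by blast
  obtain w where w: "w \<in> nodes" "q = pos s (emb w)" using corner_is_node[OF e(3) b(2) s(1)] \<open>q \<in> t\<close> s(2) by blast
  have uw: "u \<noteq> w" using u w e(4) by blast
  define M where "M = (1 - 1/2) *\<^sub>R emb u + (1/2) *\<^sub>R emb w"
  have M: "pos s M = (1 - 1/2) *\<^sub>R p + (1/2) *\<^sub>R q"
    unfolding M_def affine_mapD[OF pos_affine(1)[OF s(1)]] u(2) w(2) ..
  have Mo: "pos s M \<in> open_segment p q" unfolding M by (rule midpoint_in_open_segment[OF e(4)])
  then have "pos s M \<in> frontier (region s)" using e(6) s(2) open_closed_segment by blast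
  then have Mb: "M \<in> tri - tri_interior"
    unfolding frontier_region[OF s(1)] using pos_affine(2)[OF s(1)] by (auto simp: inj_eq)
  consider (dart) a where "(u,w,a) \<in> darts" | (leg) "{u,w} = {(0,0),(0,2)}" | (diag) "{u,w} = {(1,0),(0,1)}"
    using u(1) w(1) uw unfolding nodes_def darts_def by (elim insertE emptyE) (auto simp: insert_commute)
  then show ?thesis
  proof cases
    case dart
    then show ?thesis unfolding edge_colour_def e(1) u(2) w(2) using s(1) by blast
  next
    case diag
    then have "M \<in> tri_interior" unfolding M_def tri_interior_def by (auto simp: doubleton_eq_iff emb_def)
    then show ?thesis using Mb by simp
  next
    case leg
    then have M01: "M = emb (0,1)" unfolding M_def by (auto simp: doubleton_eq_iff emb_def)
    have "open_segment p q \<subseteq> ball 0 R"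
      using b by (meson convex_ball convex_contains_open_segment)
    then have MR: "pos s M \<in> ball 0 R" using Mo by blast
    have nc: "pos s M \<notin> corner_points T" using e(7) Mo by blast
    have "pos s M \<notin> interior t"
      unfolding s(2) interior_region[OF s(1)] using Mb pos_affine(2)[OF s(1)] by (auto simp: inj_eq)
    then obtain t' where t': "t' \<in> T" "t' \<noteq> t" "pos s M \<in> t'" using other_tile e(5) MR by blast
    then obtain s' where s': "s' \<in> level n" "t' = region s'" using coverD MR by blast
    then obtain z where z: "z \<in> tri" "pos s M = pos s' z" using t'(3) by (auto simp: region_def)
    have "(0,1) \<in> nodes" by (simp add: nodes_def)
    then obtain v where v: "v \<in> nodes" "fst s (emb (0,1)) = fst s' (emb v)"
      using compatible_node[OF level_compatible[OF s(1) s'(1)]] z M01 pos_eq by metis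
    have "v \<notin> corners"
    proof
      assume "v \<in> corners"
      then have "pos s' (emb v) \<in> corner_points T" using corner_pointI s' t'(1) by blast
      then show False using nc v(2) M01 pos_eq by metis
    qed
    then have "v = (0,1)" using v(1) by (auto simp: nodes_def corners_def)
    then have "fst s (emb (0,1)) = fst s' (emb (0,1))" using v(2) by simp
    moreover have "s \<noteq> s'" using t'(2) s s' by blast
    ultimately obtain m r where r: "n = Suc m" "r \<in> level m" "s = child 1 r \<or> s = child 3 r"
      using shared_midpoint[OF s(1) s'(1)] by blast
    have "e = {pos s (emb (0,0)), pos s (emb (0,2))}"
      unfolding e(1) u(2) w(2) using leg by (auto simp: doubleton_eq_iff)
    then have "e = {H (free_end r), H (far_end r)}"
      unfolding pos_apply using r(3) by (elim disjE) (simp_all only: long_leg_child insert_commute)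
    then show ?thesis unfolding edge_colour_def using r by blast
  qed
qed

lemma leg_mid_between: "H (leg_mid r) = (1 - 1/2) *\<^sub>R H (free_end r) + (1/2) *\<^sub>R H (far_end r)"
  if "r \<in> level m"
proof -
  have r: "affine_map (fst r)" using affine_inj_level[OF that] by (simp add: affine_inj_def)
  have "unturn (1, 1) = (1 - 1/2) *\<^sub>R unturn (1, 0) + (1/2) *\<^sub>R unturn (1, 2)"
    by (simp add: unturn_def)
  then show ?thesis
    unfolding leg_mid_def free_end_def far_end_def
    by (simp only: affine_mapD[OF r] affine_mapD[OF H_affine(1)])
qed

lemma leg_mid_not_corner:
  assumes "e \<in> corner_edges T" "e = {H (free_end r), H (far_end r)}" "r \<in> level m"
  shows "H (leg_mid r) \<notin> corner_points T"
proof -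
  obtain p q where e: "e = {p,q}" "p \<noteq> q" "open_segment p q \<inter> corner_points T = {}"
    using assms(1) unfolding corner_edges_def by blast
  then have *: "open_segment (H (free_end r)) (H (far_end r)) = open_segment p q" "H (free_end r) \<noteq> H (far_end r)"
    using assms(2) by (auto simp: doubleton_eq_iff open_segment_commute)
  then show ?thesis using e(3) midpoint_in_open_segment[OF *(2)] leg_mid_between[OF assms(3)] by fastforce
qed

lemma edge_colour_cases:
  assumes "edge_colour e k" "v \<in> e"
  obtains (dart) s u w a where "s \<in> level n" "(u,w,a) \<in> darts" "v = pos s (emb u)" "e = {v, pos s (emb w)}"
      "k = (snd s + a) mod 8"
  | (leg) m r where "r \<in> level m" "n = Suc m" "e = {H (free_end r), H (far_end r)}" "k = (5 - snd r) mod 8"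
proof -
  consider (d) s u w a where "s \<in> level n" "(u,w,a) \<in> darts" "e = {pos s (emb u), pos s (emb w)}" "k = (snd s + a) mod 8"
    | (l) m r where "r \<in> level m" "n = Suc m" "e = {H (free_end r), H (far_end r)}" "k = (5 - snd r) mod 8"
    using assms(1) unfolding edge_colour_def by blast
  then show thesis
  proof cases
    case d
    then consider "v = pos s (emb u)" | "v = pos s (emb w)" using assms(2) by blast
    then show thesis
    proof cases
      case 1 then show thesis using dart[OF d(1,2)] d by simp
    next
      case 2 then show thesis using dart[OF d(1) dart_nodes(4)[OF d(2)]] d by (simp add: insert_commute)
    qed
  next
    case l then show thesis using leg by blast
  qed
qed

lemma leg_dart_clash:
  assumes e: "e \<in> corner_edges T" "e' \<in> corner_edges T" and v: "v \<in> e" "v \<in> e'"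
    and leg: "r \<in> level m" "n = Suc m" "e = {H (free_end r), H (far_end r)}" "k = (5 - snd r) mod 8"
    and dart: "s \<in> level n" "(u,w,a) \<in> darts" "v = pos s (emb u)" "e' = {v, pos s (emb w)}" "k = (snd s + a) mod 8"
  shows False
proof -
  have "fst s (emb u) = free_end r \<or> fst s (emb u) = far_end r"
    using v(1) leg(3) dart(3) H_affine(2) by (auto simp: pos_apply inj_eq)
  moreover have "8 dvd (snd s + a) - (5 - snd r)" using leg(4) dart(5) by (simp add: mod_eq_dvd_iff)
  ultimately have "fst s (emb w) = leg_mid r"
    using far_end_dart(2)[OF leg(1) _ dart(2)] dart(1) leg(2) by blast
  then have "H (leg_mid r) \<in> e'" using dart(4) by (simp add: pos_apply)
  moreover have "e' \<subseteq> corner_points T" using e(2) unfolding corner_edges_def by blast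
  ultimately show False using leg_mid_not_corner[OF e(1) leg(3,1)] by blast
qed

lemma edge_colour_proper:
  assumes e: "e \<in> corner_edges T" "e' \<in> corner_edges T" "e \<noteq> e'" and v: "v \<in> e" "v \<in> e'"
    and k: "edge_colour e k" "edge_colour e' k"
  shows False
  using k(1) v(1)
proof (cases rule: edge_colour_cases)
  case d: (dart s u w a)
  from k(2) v(2) show False
  proof (cases rule: edge_colour_cases)
    case d': (dart s' u' w' a')
    have "fst s (emb u) = fst s' (emb u')" using d(3) d'(3) pos_eq by metis
    moreover have "(snd s + a) mod 8 = (snd s' + a') mod 8" using d(5) d'(5) by simp
    then have "8 dvd (snd s + a) - (snd s' + a')" unfolding mod_eq_dvd_iff .
    ultimately have "fst s (emb w) = fst s' (emb w')"
      using compatible_dart[OF level_compatible[OF d(1) d'(1)] d(2) d'(2)] by blast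
    then show False using d(4) d'(4) e(3) by (simp add: pos_apply)
  next
    case (leg m r)
    then show False using leg_dart_clash[OF e(2,1) v(2,1) leg d] by blast
  qed
next
  case l: (leg m r)
  from k(2) v(2) show False
  proof (cases rule: edge_colour_cases)
    case (dart s u w a)
    then show False using leg_dart_clash[OF e(1,2) v l dart] by blast
  next
    case l': (leg m' r')
    have m: "m' = m" using l(2) l'(2) by simp
    have ne: "r \<noteq> r'" using l(3) l'(3) e(3) by blast
    have r': "r' \<in> level m" using l'(1) m by simp
    note free = free_end_neq[OF l(1) r' ne] free_end_neq[OF r' l(1) ne[symmetric]]
    have "far_end r = far_end r'"
      using v l(3) l'(3) free H_affine(2) by (auto simp: inj_eq)
    moreover have "(5 - snd r) mod 8 = (5 - snd r') mod 8" using l(4) l'(4) by simp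
    then have "8 dvd (5 - snd r) - (5 - snd r')" unfolding mod_eq_dvd_iff .
    ultimately show False using far_end_colour[OF l(1) r'] ne by blast
  qed
qed

lemma edge_extension:
  assumes "s \<in> level n" "region s \<subseteq> ball 0 R" "(u,w,a) \<in> darts" "u \<in> corners"
  obtains c where "c = 1 \<or> c = 2" "{pos s (emb u), pos s (emb u) + c *\<^sub>R (pos s (emb w) - pos s (emb u))} \<in> corner_edges T"
proof -
  have reg: "pos s (emb v) \<in> region s" if "v \<in> nodes" for v using that nodes_in_tri by (simp add: region_def)
  note n = dart_nodes[OF assms(3)]
  have T: "region s \<in> T" using region_in_tiling[OF assms(1) reg[OF n(1)]] assms(2) reg[OF n(1)] by blast
  have nd: "\<exists>v'\<in>nodes. x = pos s (emb v') \<and> emb v' \<in> open_segment (emb p) (emb q)"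
    if x: "x \<in> corner_points T" "x \<in> open_segment (pos s (emb p)) (pos s (emb q))" "p \<in> nodes" "q \<in> nodes" for x p q
  proof -
    obtain z where z: "z \<in> open_segment (emb p) (emb q)" "x = pos s z"
      using x(2) affine_open_segment[OF pos_affine[OF assms(1)]] unfolding in_segment
      by (metis affine_mapD pos_affine(1)[OF assms(1)])
    have "z \<in> tri" using z(1) x(3,4) nodes_in_tri convex_tri
      by (meson convex_contains_open_segment subsetD)
    then have "x \<in> region s" using z by (simp add: region_def)
    then obtain v' where "v' \<in> nodes" "x = pos s (emb v')"
      using corner_is_node[OF x(1) _ assms(1)] assms(2) by blast
    moreover then have "z = emb v'" using z(2) pos_affine(2)[OF assms(1)] by (simp add: inj_eq)
    ultimately show ?thesis using z(1) by blast
  qed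
  have fr: "closed_segment (pos s (emb p)) (pos s (emb q)) \<subseteq> frontier (region s)"
    if "(p,q,b) \<in> darts \<or> p = (0,0) \<and> q = (0,2) \<or> p = (0,2) \<and> q = (0,0)" for p q b
  proof
    fix x assume "x \<in> closed_segment (pos s (emb p)) (pos s (emb q))"
    then obtain t where t: "0 \<le> t" "t \<le> 1" "x = (1 - t) *\<^sub>R pos s (emb p) + t *\<^sub>R pos s (emb q)"
      unfolding closed_segment_def by blast
    then have "x = pos s ((1 - t) *\<^sub>R emb p + t *\<^sub>R emb q)" using affine_mapD[OF pos_affine(1)[OF assms(1)]] by simp
    moreover have "(1 - t) *\<^sub>R emb p + t *\<^sub>R emb q \<in> closed_segment (emb p) (emb q)"
      using t unfolding closed_segment_def by blast
    then have "(1 - t) *\<^sub>R emb p + t *\<^sub>R emb q \<in> tri - tri_interior" using side_in_boundary[OF that] by blast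
    ultimately show "x \<in> frontier (region s)" unfolding frontier_region[OF assms(1)] by blast
  qed
  have vc: "pos s (emb u) \<in> corner_points T" using corner_pointI[OF assms(1) T assms(4)] .
  have inj: "pos s (emb p) \<noteq> pos s (emb q)" if "p \<noteq> q" for p q
    using that pos_affine(2)[OF assms(1)] by (simp add: inj_eq)
  show thesis
  proof (cases "pos s (emb w) \<in> corner_points T")
    case True
    have "open_segment (pos s (emb u)) (pos s (emb w)) \<inter> corner_points T = {}"
      using nd[OF _ _ n(1,2)] node_not_in_open_edge[OF assms(3)] by blast
    then have "{pos s (emb u), pos s (emb w)} \<in> corner_edges T"
      unfolding corner_edges_def using True vc T fr[of u w a] assms(3) inj[OF n(3)] by blast
    then show thesis using that[of 1] by simp
  next
    case False
    then have "w \<notin> corners" using corner_pointI[OF assms(1) T] by blast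
    then have w: "w = (0,1)" using n(2) by (auto simp: nodes_def corners_def)
    then have u: "u = (0,0) \<or> u = (0,2)" using assms(3) by (auto simp: darts_def)
    define u' where "u' = ((0, 2 - snd u) :: int \<times> int)"
    have u': "u' \<in> corners" "u' \<in> nodes" "u' \<noteq> u" "u = (0,0) \<and> u' = (0,2) \<or> u = (0,2) \<and> u' = (0,0)"
      using u by (auto simp: u'_def corners_def nodes_def)
    have "emb w = (1 - 1/2) *\<^sub>R emb u + (1/2) *\<^sub>R emb u'" using u'(4) w by (auto simp: emb_def)
    then have "pos s (emb w) = (1 - 1/2) *\<^sub>R pos s (emb u) + (1/2) *\<^sub>R pos s (emb u')"
      by (simp only: affine_mapD[OF pos_affine(1)[OF assms(1)]])
    then have e: "pos s (emb u) + 2 *\<^sub>R (pos s (emb w) - pos s (emb u)) = pos s (emb u')"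
      by (simp add: prod_eq_iff)
    have "open_segment (pos s (emb u)) (pos s (emb u')) \<inter> corner_points T = {}"
    proof (rule ccontr)
      assume "\<not> ?thesis"
      then obtain x v' where x: "x \<in> corner_points T" "v' \<in> nodes" "x = pos s (emb v')" "emb v' \<in> open_segment (emb u) (emb u')"
        using nd[OF _ _ n(1) u'(2)] by blast
      then have "v' = (0,1)" using node_in_long_leg[of v'] u'(4) open_segment_commute by metis
      then show False using False x(1,3) w by simp
    qed
    moreover have "pos s (emb u') \<in> corner_points T" using corner_pointI[OF assms(1) T u'(1)] .
    ultimately have "{pos s (emb u), pos s (emb u')} \<in> corner_edges T"
      unfolding corner_edges_def using vc T fr[of u u' 0] u'(4) inj[OF u'(3)[symmetric]] by blast
    then show thesis using that[of 2] e by simp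
  qed
qed

end

lemma isometry_surj:
  assumes "isometry f" shows "surj f"
proof -
  have "orthogonal_transformation (\<lambda>x. f x - f 0)"
    using assms unfolding orthogonal_transformation_isometry isometry_def by (simp add: dist_norm)
  then have "surj (\<lambda>x. f x - f 0)" by (rule orthogonal_transformation_surj)
  then have "\<exists>x. y - f 0 = f x - f 0" for y by (rule surjD)
  then have "\<exists>x. y = f x" for y by simp
  then show ?thesis unfolding surj_def by blast
qed

lemma tri_diameter: "x \<in> tri \<Longrightarrow> y \<in> tri \<Longrightarrow> dist x y \<le> 3"
proof -
  assume "x \<in> tri" "y \<in> tri"
  then have "\<bar>fst x - fst y\<bar> \<le> 1" "\<bar>snd x - snd y\<bar> \<le> 2" by (auto simp: tri_def)
  moreover have "dist x y \<le> dist (fst x) (fst y) + dist (snd x) (snd y)"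
    unfolding dist_prod_def by (rule sqrt_sum_squares_le_sum) auto
  ultimately show ?thesis by (simp add: dist_real_def)
qed

lemma tri_centre: "dist y (1/4, 1/4) < 1/10 \<Longrightarrow> y \<in> tri_interior"
proof -
  assume "dist y (1/4, 1/4) < 1/10"
  then have "dist (fst y) (1/4) < 1/10" "dist (snd y) (1/4) < 1/10"
    using dist_fst_le[of y "(1/4,1/4)"] dist_snd_le[of y "(1/4,1/4)"] by auto
  then show ?thesis unfolding tri_interior_def dist_real_def by (simp add: abs_if split: if_splits)
qed

lemma finite_separated:
  fixes C :: "plane set"
  assumes "bounded C" "0 < e" "\<And>x y. x \<in> C \<Longrightarrow> y \<in> C \<Longrightarrow> x \<noteq> y \<Longrightarrow> e \<le> dist x y"
  shows "finite C"
proof (rule ccontr)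
  assume "infinite C"
  then obtain x where x: "x islimpt C" using bounded_infinite_imp_islimpt[OF subset_refl assms(1)] by blast
  obtain y where y: "y \<in> C" "y \<noteq> x" "dist y x < e / 2"
    using x assms(2) unfolding islimpt_approachable by (metis half_gt_zero)
  obtain z where z: "z \<in> C" "z \<noteq> x" "dist z x < min (e / 2) (dist y x)"
    using x assms(2) y(2) unfolding islimpt_approachable
    by (metis half_gt_zero min_less_iff_conj zero_less_dist_iff)
  have "dist y z < e" using y(3) z(3) dist_triangle2[of y z x] by simp
  then show False using assms(3)[of y z] y z by auto
qed

lemma locally_finite:
  assumes "tiling_by_prototile T" shows "finite {t\<in>T. t \<inter> ball 0 R \<noteq> {}}" (is "finite ?P")
proof -
  have "\<forall>t\<in>T. \<exists>f. isometry f \<and> t = f ` tri" using assms unfolding tiling_by_prototile_def prototile_eq by blast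
  then obtain F where F: "\<And>t. t \<in> T \<Longrightarrow> isometry (F t) \<and> t = F t ` tri" by metis
  define c where "c t = F t (1/4, 1/4)" for t
  have int: "interior t = F t ` tri_interior" if "t \<in> T" for t
    using affine_interior[OF isometry_affine, of "F t" tri] F[OF that] interior_tri by simp
  have c0: "(1/4, 1/4) \<in> tri_interior" "(1/4, 1/4) \<in> tri" by (simp_all add: tri_interior_def tri_def)
  have sep: "1/10 \<le> dist (c s) (c t)" if st: "s \<in> T" "t \<in> T" "s \<noteq> t" for s t
  proof (rule ccontr)
    assume "\<not> ?thesis"
    then have d: "dist (c t) (c s) < 1/10" by (simp add: dist_commute)
    obtain y where y: "c t = F s y" using isometry_surj[of "F s"] F[OF st(1)] by (metis surjD)
    have "dist y (1/4,1/4) < 1/10" using d y F[OF st(1)] isometryD[of "F s" y] by (simp add: c_def)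
    then have "c t \<in> interior s" using y int[OF st(1)] tri_centre by blast
    moreover have "c t \<in> interior t" using int[OF st(2)] c0(1) by (simp add: c_def)
    ultimately show False using assms st unfolding tiling_by_prototile_def pairwise_def by blast
  qed
  have "c ` ?P \<subseteq> ball 0 (R + 4)"
  proof
    fix x assume "x \<in> c ` ?P"
    then obtain t y where t: "t \<in> T" "x = c t" "y \<in> t" "y \<in> ball 0 R" by blast
    then obtain z where z: "z \<in> tri" "y = F t z" using F by blast
    have "dist x y \<le> 3" using tri_diameter[OF c0(2) z(1)] F[OF t(1)] isometryD[of "F t"] t(2) z(2) by (simp add: c_def)
    then show "x \<in> ball 0 (R + 4)" using t(4) dist_triangle[of 0 x y] by (simp add: dist_commute)
  qed
  then have "bounded (c ` ?P)" using bounded_ball bounded_subset by blast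
  then have "finite (c ` ?P)"
  proof (rule finite_separated[of _ "1/10"])
    fix x y assume "x \<in> c ` ?P" "y \<in> c ` ?P" "x \<noteq> y"
    then obtain s t where "s \<in> T" "t \<in> T" "x = c s" "y = c t" by blast
    then show "1/10 \<le> dist x y" using sep \<open>x \<noteq> y\<close> by metis
  qed simp
  moreover have "inj_on c ?P" using sep by (force simp: inj_on_def)
  ultimately show ?thesis by (rule finite_imageD)
qed

lemma patch_exists:
  assumes "rational_pinwheel_tiling T" shows "\<exists>f n. patch T f n R"
proof -
  have t: "tiling_by_prototile T" using assms by (simp add: rational_pinwheel_tiling_def)
  define P where "P = {t\<in>T. t \<inter> ball 0 R \<noteq> {}}"
  have "finite P" unfolding P_def by (rule locally_finite[OF t])
  moreover have "P \<subseteq> T" unfolding P_def by blast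
  ultimately obtain n f where f: "isometry f" "P \<subseteq> (\<lambda>t. f ` t) ` supertile n"
    using assms unfolding rational_pinwheel_tiling_def by metis
  have "patch T f n R"
  proof
    fix t assume "t \<in> T" "t \<inter> ball 0 R \<noteq> {}"
    then have "t \<in> (\<lambda>t. f ` t) ` supertile n" using f(2) by (auto simp: P_def)
    then show "\<exists>s\<in>level n. t = (f \<circ> inflate n \<circ> fst s) ` tri"
      unfolding supertile_eq by (auto simp: image_comp comp_assoc)
  qed (use t f in auto)
  then show ?thesis by blast
qed

section \<open>The bounds\<close>

lemma colouring_compactness:
  fixes E :: "'b set" and adj :: "'b \<Rightarrow> 'b \<Rightarrow> bool" and K :: "'c set"
  assumes "finite K"
    and fin: "\<And>F. finite F \<Longrightarrow> F \<subseteq> E \<Longrightarrow>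
      \<exists>c. c ` F \<subseteq> K \<and> (\<forall>e\<in>F. \<forall>e'\<in>F. adj e e' \<longrightarrow> c e \<noteq> c e')"
  shows "\<exists>c. c ` E \<subseteq> K \<and> (\<forall>e\<in>E. \<forall>e'\<in>E. adj e e' \<longrightarrow> c e \<noteq> c e')"
proof (cases "E = {}")
  case True
  then show ?thesis by simp
next
  case False
  then obtain e0 where "e0 \<in> E" by blast
  then obtain k0 where k0: "k0 \<in> K" using fin[of "{e0}"] by auto
  define X where "X = product_topology (\<lambda>_::'b. discrete_topology K) E"
  have top: "topspace X = E \<rightarrow>\<^sub>E K" by (simp add: X_def)
  have compact: "compact_space X"
    using assms(1) by (simp add: X_def compact_space_product_topology compact_space_discrete_topology)
  define Z where "Z p = {c \<in> topspace X. c (fst p) \<noteq> c (snd p)}" for p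
  have closedZ: "closedin X (Z p)" if "p \<in> E \<times> E" for p
  proof -
    have cl: "closedin X {c \<in> topspace X. c e \<in> {a}}" if "e \<in> E" "a \<in> K" for e a
      using continuous_map_product_projection[OF that(1), of "\<lambda>_. discrete_topology K"]
      unfolding X_def by (rule closedin_continuous_map_preimage) (use that(2) in simp)
    define D where "D = {r \<in> K \<times> K. fst r \<noteq> snd r}"
    define Y where "Y r = {c \<in> topspace X. c (fst p) \<in> {fst r}} \<inter> {c \<in> topspace X. c (snd p) \<in> {snd r}}" for r
    have "finite D" by (simp add: D_def assms(1))
    moreover have "closedin X (Y r)" if "r \<in> D" for r
      unfolding Y_def using that \<open>p \<in> E \<times> E\<close> by (intro closedin_Int cl) (auto simp: D_def)
    ultimately have "closedin X (\<Union>(Y ` D))" by (intro closedin_Union) auto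
    also have "\<Union>(Y ` D) = Z p"
    proof (intro set_eqI iffI)
      fix c assume "c \<in> Z p"
      then have "(c (fst p), c (snd p)) \<in> D" "c \<in> Y (c (fst p), c (snd p))"
        using that by (auto simp: Z_def D_def Y_def top PiE_iff)
      then show "c \<in> \<Union>(Y ` D)" by blast
    qed (auto simp: Z_def Y_def D_def)
    finally show ?thesis .
  qed
  define adjs where "adjs = {p \<in> E \<times> E. adj (fst p) (snd p)}"
  have "\<Inter>F \<noteq> {}" if F: "finite F" "F \<subseteq> insert (topspace X) (Z ` adjs)" for F
  proof -
    have "F - {topspace X} \<subseteq> Z ` adjs" using F(2) by auto
    from finite_subset_image[OF finite_Diff[OF F(1)] this]
    obtain Q where Q: "finite Q" "Q \<subseteq> adjs" "F - {topspace X} = Z ` Q" by (elim exE conjE)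
    define V where "V = fst ` Q \<union> snd ` Q"
    have V: "finite V" "V \<subseteq> E" using Q(1,2) by (auto simp: V_def adjs_def)
    obtain c where c: "c ` V \<subseteq> K" "\<forall>e\<in>V. \<forall>e'\<in>V. adj e e' \<longrightarrow> c e \<noteq> c e'" using fin[OF V] by blast
    define d where "d = (\<lambda>e\<in>E. if e \<in> V then c e else k0)"
    have d: "d \<in> topspace X" using c(1) k0 by (auto simp: d_def top image_subset_iff)
    have "d \<in> Z p" if "p \<in> Q" for p
    proof -
      have p: "fst p \<in> V" "snd p \<in> V" "adj (fst p) (snd p)" using that Q(2) by (auto simp: V_def adjs_def)
      then show ?thesis using c(2) d V(2) by (auto simp: Z_def d_def)
    qed
    then have "d \<in> \<Inter>F" using Q(3) d by blast
    then show ?thesis by blast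
  qed
  moreover have "closedin X C" if "C \<in> insert (topspace X) (Z ` adjs)" for C
    using that closedZ by (auto simp: adjs_def)
  ultimately have "\<Inter>(insert (topspace X) (Z ` adjs)) \<noteq> {}"
    using compact[unfolded compact_space_fip, rule_format, of "insert (topspace X) (Z ` adjs)"] by blast
  then obtain c where c: "c \<in> topspace X" "\<And>p. p \<in> adjs \<Longrightarrow> c \<in> Z p" by blast
  show ?thesis
  proof (intro exI[of _ c] conjI ballI impI)
    show "c ` E \<subseteq> K" using c(1) top by auto
    fix e e' assume "e \<in> E" "e' \<in> E" "adj e e'"
    then have "(e,e') \<in> adjs" by (simp add: adjs_def)
    then show "c e \<noteq> c e'" using c(2) by (fastforce simp: Z_def)
  qed
qed

lemma eight_colouring:
  assumes "rational_pinwheel_tiling T"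
  shows "\<exists>c. proper_edge_colouring (tiling_graph T) c \<and> c ` snd (tiling_graph T) \<subseteq> {..<8}"
proof -
  have "\<exists>c. c ` corner_edges T \<subseteq> {..<8::nat} \<and>
    (\<forall>e\<in>corner_edges T. \<forall>e'\<in>corner_edges T. e \<noteq> e' \<and> e \<inter> e' \<noteq> {} \<longrightarrow> c e \<noteq> c e')"
  proof (rule colouring_compactness)
    fix F assume F: "finite F" "F \<subseteq> corner_edges T"
    then have "finite (\<Union>F)" by (auto simp: corner_edges_def)
    then obtain R where R: "\<Union>F \<subseteq> ball 0 R" using bounded_subset_ballD finite_imp_bounded by metis
    obtain f n where "patch T f n R" using patch_exists[OF assms] by blast
    then interpret patch T f n R .
    have "\<forall>e\<in>F. \<exists>k. edge_colour e k" using edge_coloured F(2) R by blast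
    then obtain c where c: "\<And>e. e \<in> F \<Longrightarrow> edge_colour e (c e)" by metis
    have r: "0 \<le> c e \<and> c e < 8" if "e \<in> F" for e using c[OF that] by (auto simp: edge_colour_def)
    show "\<exists>c. c ` F \<subseteq> {..<8::nat} \<and> (\<forall>e\<in>F. \<forall>e'\<in>F. e \<noteq> e' \<and> e \<inter> e' \<noteq> {} \<longrightarrow> c e \<noteq> c e')"
    proof (intro exI[of _ "nat \<circ> c"] conjI ballI impI)
      show "(nat \<circ> c) ` F \<subseteq> {..<8}" using r by fastforce
      fix e e' assume e: "e \<in> F" "e' \<in> F" "e \<noteq> e' \<and> e \<inter> e' \<noteq> {}"
      then obtain v where v: "v \<in> e" "v \<in> e'" by blast
      have "c e \<noteq> c e'" using edge_colour_proper[of e e' v "c e"] c[OF e(1)] c[OF e(2)] e v F(2) by force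
      then show "(nat \<circ> c) e \<noteq> (nat \<circ> c) e'" using r[OF e(1)] r[OF e(2)] by (simp add: eq_nat_nat_iff)
    qed
  qed simp
  then obtain c where "c ` corner_edges T \<subseteq> {..<8::nat}"
    "\<forall>e\<in>corner_edges T. \<forall>e'\<in>corner_edges T. e \<noteq> e' \<and> e \<inter> e' \<noteq> {} \<longrightarrow> c e \<noteq> c e'"
    by (elim exE conjE)
  then show ?thesis unfolding proper_edge_colouring_def tiling_graph_def snd_conv
    by (intro exI[of _ c] conjI)
qed

lemma octants_at_free_end:
  "\<forall>k\<in>{0,1,2,3,4,5,6,7}. \<exists>i<5. \<exists>(u,b)\<in>octants. place i u = (1,0) \<and> (shift i + b) mod 8 = k"
  unfolding octants_def all_less5 ex_less5 ball_simps bex_simps prod.case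
  by (simp add: place_simps shift_simps)

lemma octant_child:
  "\<forall>(u,b)\<in>octants. \<exists>i<5. \<exists>(v,c)\<in>octants. place i v = turn u \<and> 8 dvd (shift i + c) + b + 1 \<and>
     v \<noteq> (0,1) \<and> (u \<noteq> (0,1) \<longrightarrow> v = (1,0) \<or> v = (0,2))"
  unfolding octants_def all_less5 ex_less5 ball_simps bex_simps prod.case
  by (simp add: place_simps shift_simps turn_def)

lemma octant_dart:
  "\<forall>(u,b)\<in>octants. u = (1,0) \<or> u = (0,2) \<longrightarrow> (\<exists>(v,w,a)\<in>darts. v = u \<and> a = b)"
  unfolding octants_def darts_def ball_simps bex_simps prod.case by simp

lemma octant_child_position:
  assumes "(u,b) \<in> octants"
  obtains i v c where "i < 5" "(v,c) \<in> octants" "fst (child i s) (emb v) = fst s (emb u)"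
    "8 dvd (snd (child i s) + c) + (snd s + b) + 1" "v \<noteq> (0,1)" "u \<noteq> (0,1) \<Longrightarrow> v = (1,0) \<or> v = (0,2)"
proof -
  have "\<exists>i<5. \<exists>(v,c)\<in>octants. place i v = turn u \<and> 8 dvd (shift i + c) + b + 1 \<and>
     v \<noteq> (0,1) \<and> (u \<noteq> (0,1) \<longrightarrow> v = (1,0) \<or> v = (0,2))"
    using octant_child assms by blast
  then obtain i v c where i: "i < 5" "(v,c) \<in> octants" "place i v = turn u" "8 dvd (shift i + c) + b + 1"
     "v \<noteq> (0,1)" "u \<noteq> (0,1) \<longrightarrow> v = (1,0) \<or> v = (0,2)" by blast
  have "fst (child i s) (emb v) = fst s (emb u)"
    unfolding fst_child emb_place[symmetric] i(3) by simp
  moreover have e: "(snd (child i s) + c) + (snd s + b) + 1 = (shift i + c) + b + 1" by (simp add: snd_child)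
  have "8 dvd (snd (child i s) + c) + (snd s + b) + 1" unfolding e by (rule i(4))
  ultimately show thesis using that[OF i(1,2)] i(5,6) by blast
qed

lemma level_in_tri: "s \<in> level n \<Longrightarrow> z \<in> tri \<Longrightarrow> fst s z \<in> tri"
proof (induction n arbitrary: s z)
  case (Suc n)
  then obtain i r where r: "i < 5" "s = child i r" "r \<in> level n" by auto
  then have "unturn (place i z) \<in> tri" using place_tri_subset Suc.prems(2) unturn_in_tri by blast
  then show ?case using Suc.IH r(2,3) fst_child by simp
qed simp

lemma child_in_tri: "i < 5 \<Longrightarrow> z \<in> tri \<Longrightarrow> fst (child i r) z \<in> fst r ` tri"
  using place_tri_subset[of i z] unturn_in_tri unfolding fst_child by blast

lemma parent_region:
  assumes "s \<in> level (Suc n)" obtains r where "r \<in> level n" "fst s ` tri \<subseteq> fst r ` tri"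
proof -
  obtain i r where r: "s = child i r" "i < 5" "r \<in> level n" using assms unfolding level.simps by blast
  have "fst s ` tri \<subseteq> fst r ` tri" unfolding r(1) by (intro image_subsetI child_in_tri r(2))
  then show thesis using that r(3) by blast
qed

lemma children_edges:
  assumes "r \<in> level m" "0 \<le> k" "k < 8"
  obtains s u w a where "s \<in> level (Suc (Suc (Suc m)))" "(u,w,a) \<in> darts" "u \<in> corners"
    "fst s (emb u) = free_end r" "(snd s + a) mod 8 = k" "fst s ` tri \<subseteq> fst r ` tri"
proof -
  define j where "j = (k + snd r) mod 8"
  have "0 \<le> j" "j < 8" by (simp_all add: j_def)
  then have "j = 0 \<or> j = 1 \<or> j = 2 \<or> j = 3 \<or> j = 4 \<or> j = 5 \<or> j = 6 \<or> j = 7" by linarith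
  then have "j \<in> {0,1,2,3,4,5,6,7}" by simp
  with octants_at_free_end have "\<exists>i<5. \<exists>(u,b)\<in>octants. place i u = (1,0) \<and> (shift i + b) mod 8 = j"
    by (rule bspec)
  then obtain i1 u1 b1 where 1: "i1 < 5" "(u1,b1) \<in> octants" "place i1 u1 = (1,0)" "(shift i1 + b1) mod 8 = j"
    by blast
  define s1 where "s1 = child i1 r"
  have s1: "fst s1 (emb u1) = free_end r"
    unfolding s1_def fst_child emb_place[symmetric] 1(3) free_end_def by (simp add: emb_def)
  have k1: "8 dvd (snd s1 + b1) - k"
    using 1(4) unfolding j_def mod_eq_dvd_iff s1_def snd_child by (simp add: algebra_simps)
  obtain i2 u2 b2 where 2: "i2 < 5" "(u2,b2) \<in> octants" "fst (child i2 s1) (emb u2) = fst s1 (emb u1)"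
    "8 dvd (snd (child i2 s1) + b2) + (snd s1 + b1) + 1" "u2 \<noteq> (0,1)"
    using octant_child_position[OF 1(2)] by metis
  define s2 where "s2 = child i2 s1"
  obtain i3 u3 b3 where 3: "i3 < 5" "(u3,b3) \<in> octants" "fst (child i3 s2) (emb u3) = fst s2 (emb u2)"
    "8 dvd (snd (child i3 s2) + b3) + (snd s2 + b2) + 1" "u3 = (1,0) \<or> u3 = (0,2)"
    using octant_child_position[OF 2(2)] 2(5) by metis
  define s3 where "s3 = child i3 s2"
  have "\<exists>(v,w,a)\<in>darts. v = u3 \<and> a = b3" using octant_dart 3(2,5) by blast
  then obtain w where w: "(u3,w,b3) \<in> darts" by blast
  show thesis
  proof
    show "s3 \<in> level (Suc (Suc (Suc m)))"
      unfolding s3_def s2_def s1_def by (intro child_level assms(1) 1(1) 2(1) 3(1))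
    show "(u3,w,b3) \<in> darts" by (rule w)
    show "u3 \<in> corners" using 3(5) by (auto simp: corners_def)
    show "fst s3 (emb u3) = free_end r" using 3(3) 2(3) s1 by (simp add: s3_def s2_def)
    have e: "(snd s3 + b3) - (snd s1 + b1) = ((snd (child i3 s2) + b3) + (snd s2 + b2) + 1) -
      ((snd (child i2 s1) + b2) + (snd s1 + b1) + 1)"
      by (simp add: s3_def s2_def)
    have "8 dvd (snd s3 + b3) - (snd s1 + b1)"
      unfolding e by (rule dvd_diff[OF 3(4) 2(4)])
    moreover have e2: "(snd s3 + b3) - k = ((snd s3 + b3) - (snd s1 + b1)) + ((snd s1 + b1) - k)" by simp
    ultimately have "8 dvd (snd s3 + b3) - k" unfolding e2 using k1 by (intro dvd_add)
    then have "(snd s3 + b3) mod 8 = k mod 8" by (simp only: mod_eq_dvd_iff)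
    then show "(snd s3 + b3) mod 8 = k" using assms(2,3) by simp
    have "fst s3 z \<in> fst r ` tri" if z: "z \<in> tri" for z
    proof -
      obtain z2 where z2: "z2 \<in> tri" "fst s3 z = fst s2 z2" using child_in_tri[OF 3(1) z] unfolding s3_def by blast
      obtain z1 where z1: "z1 \<in> tri" "fst s2 z2 = fst s1 z1" using child_in_tri[OF 2(1) z2(1)] unfolding s2_def by blast
      show ?thesis using child_in_tri[OF 1(1) z1(1)] z1(2) z2(2) unfolding s1_def by simp
    qed
    then show "fst s3 ` tri \<subseteq> fst r ` tri" by blast
  qed
qed

context patch begin

lemma dist_H: "dist (H x) (H y) = sqrt 5 ^ n * dist x y"
proof -
  have "dist (H x) (H y) = dist (inflate n x) (inflate n y)" by (simp add: H_def isometryD[OF iso])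
  also have "\<dots> = sqrt 5 ^ n * dist x y"
    unfolding inflate_def dist_norm scaleR_diff_right[symmetric] norm_scaleR by simp
  finally show ?thesis .
qed

lemma sqrt5_le: "sqrt 5 \<le> 3"
  by (rule real_le_lsqrt) simp_all

lemma tile_at: "x \<in> ball 0 R \<Longrightarrow> \<exists>s\<in>level n. x \<in> region s"
proof -
  assume x: "x \<in> ball 0 R"
  have "\<Union>T = UNIV" using tiling by (simp add: tiling_by_prototile_def)
  then obtain t where "t \<in> T" "x \<in> t" by blast
  then show ?thesis using coverD[OF _ _ x] by metis
qed

lemma inside_inflated:
  assumes "x \<in> ball 0 R" obtains z where "z \<in> tri" "x = H z"
proof -
  obtain s where s: "s \<in> level n" "x \<in> region s" using tile_at[OF assms] by blast
  then obtain y where "y \<in> tri" "x = H (fst s y)" unfolding region_def pos_apply by blast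
  then show thesis using that level_in_tri[OF s(1)] by blast
qed

lemma large_level:
  assumes "100 \<le> R" shows "3 \<le> n"
proof (rule ccontr)
  assume "\<not> 3 \<le> n"
  then have "n \<le> 2" by simp
  have "(0::plane) \<in> ball 0 R" "(20,0) \<in> ball (0::plane) R" using assms by (auto simp: norm_Pair)
  then obtain x y where xy: "x \<in> tri" "y \<in> tri" "0 = H x" "(20,0) = H y" using inside_inflated by metis
  have "20 = dist (0::plane) (20,0)" by (simp add: norm_Pair)
  also have "\<dots> = sqrt 5 ^ n * dist x y" unfolding xy(3,4) dist_H ..
  also have "\<dots> \<le> sqrt 5 ^ n * 3" using tri_diameter xy(1,2) by simp
  also have "\<dots> \<le> sqrt 5 ^ 2 * 3"
    using power_increasing[OF \<open>n \<le> 2\<close>, of "sqrt 5"] by simp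
  finally show False by simp
qed

lemma degree_eight:
  assumes "100 \<le> R"
  obtains v e where "inj_on e {0..<8::int}" "e ` {0..<8} \<subseteq> corner_edges T" "\<And>k. k \<in> {0..<8} \<Longrightarrow> v \<in> e k"
proof -
  have "0 \<in> ball (0::plane) R" using assms by simp
  then obtain t where t: "t \<in> level n" "0 \<in> region t" using tile_at by blast
  obtain m where m: "n = Suc (Suc (Suc m))"
    using large_level[OF assms] by (metis Suc_le_D numeral_3_eq_3 Suc_le_mono)
  obtain r where r: "r \<in> level m" "fst t ` tri \<subseteq> fst r ` tri"
  proof -
    have t3: "t \<in> level (Suc (Suc (Suc m)))" using t(1) unfolding m .
    obtain t2 where t2: "t2 \<in> level (Suc (Suc m))" "fst t ` tri \<subseteq> fst t2 ` tri"
      by (rule parent_region[OF t3])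
    obtain t1 where t1: "t1 \<in> level (Suc m)" "fst t2 ` tri \<subseteq> fst t1 ` tri"
      by (rule parent_region[OF t2(1)])
    obtain r where "r \<in> level m" "fst t1 ` tri \<subseteq> fst r ` tri"
      by (rule parent_region[OF t1(1)])
    then show thesis using that[of r] t1(2) t2(2) by (meson order_trans)
  qed
  obtain z0 where z0: "z0 \<in> tri" "H (fst r z0) = 0" 
  proof -
    obtain y where y: "y \<in> tri" "0 = pos t y" using t(2) unfolding region_def by (elim imageE)
    then have "fst t y \<in> fst r ` tri" using r(2) by blast
    then obtain z where "z \<in> tri" "fst t y = fst r z" by (elim imageE)
    then show thesis using that[of z] y(2) by (simp add: pos_apply)
  qed
  have inside: "H ` fst r ` tri \<subseteq> ball 0 R"
  proof
    fix x assume "x \<in> H ` fst r ` tri"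
    then obtain z where z: "z \<in> tri" "x = H (fst r z)" by blast
    have "sqrt 5 ^ n = sqrt 5 ^ 3 * sqrt 5 ^ m" unfolding m by (simp add: power3_eq_cube)
    moreover have "dist 0 x = dist (H (fst r z0)) (H (fst r z))" using z(2) z0(2) by simp
    ultimately have "dist 0 x = sqrt 5 ^ 3 * (sqrt 5 ^ m * dist (fst r z0) (fst r z))"
      by (simp only: dist_H mult.assoc)
    also have "sqrt 5 ^ m * dist (fst r z0) (fst r z) = dist z0 z"
      using isometryD[OF isometry_level[OF r(1)], of z0 z]
      unfolding comp_def inflate_def dist_norm scaleR_diff_right[symmetric] norm_scaleR by simp
    also have "sqrt 5 ^ 3 * dist z0 z \<le> 3 ^ 3 * 3"
      using tri_diameter[OF z0(1) z(1)] by (intro mult_mono power_mono sqrt5_le) auto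
    finally show "x \<in> ball 0 R" using assms by simp
  qed
  have "\<forall>k\<in>{0..<8}. \<exists>s u w a. s \<in> level n \<and> (u,w,a) \<in> darts \<and> u \<in> corners \<and> fst s (emb u) = free_end r \<and>
      (snd s + a) mod 8 = k \<and> region s \<subseteq> ball 0 R"
  proof
    fix k :: int assume "k \<in> {0..<8}"
    then have k: "0 \<le> k" "k < 8" by simp_all
    obtain s u w a where *: "s \<in> level n" "(u,w,a) \<in> darts" "u \<in> corners"
      "fst s (emb u) = free_end r" "(snd s + a) mod 8 = k" "fst s ` tri \<subseteq> fst r ` tri"
      unfolding m by (rule children_edges[OF r(1) k])
    then have "region s \<subseteq> ball 0 R" using inside unfolding region_def pos_def image_comp[symmetric] by blast
    then show "\<exists>s u w a. s \<in> level n \<and> (u,w,a) \<in> darts \<and> u \<in> corners \<and> fst s (emb u) = free_end r \<and>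
      (snd s + a) mod 8 = k \<and> region s \<subseteq> ball 0 R" using * by blast
  qed
  then obtain S U W A where d: "\<And>k. k \<in> {0..<8} \<Longrightarrow> S k \<in> level n \<and> (U k, W k, A k) \<in> darts \<and> U k \<in> corners \<and>
      fst (S k) (emb (U k)) = free_end r \<and> (snd (S k) + A k) mod 8 = k \<and> region (S k) \<subseteq> ball 0 R"
    by metis
  define v where "v = H (free_end r)"
  define q where "q k = pos (S k) (emb (W k))" for k
  have v: "pos (S k) (emb (U k)) = v" if "k \<in> {0..<8}" for k using d[OF that] by (simp add: v_def pos_apply)
  have "\<forall>k\<in>{0..<8}. \<exists>c. (c = 1 \<or> c = 2) \<and> {v, v + c *\<^sub>R (q k - v)} \<in> corner_edges T"
    using edge_extension d v unfolding q_def by metis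
  then obtain c where c: "\<And>k. k \<in> {0..<8} \<Longrightarrow> (c k = 1 \<or> c k = 2) \<and> {v, v + c k *\<^sub>R (q k - v)} \<in> corner_edges T"
    by metis
  have no_middle: "q k - v \<noteq> 2 *\<^sub>R (q l - v)" if kl: "k \<in> {0..<8}" "l \<in> {0..<8}" for k l
  proof
    assume eq: "q k - v = 2 *\<^sub>R (q l - v)"
    let ?z = "(1 - 1/2) *\<^sub>R emb (U k) + (1/2) *\<^sub>R emb (W k)"
    have "pos (S k) ?z = (1 - 1/2) *\<^sub>R v + (1/2) *\<^sub>R q k"
      using affine_mapD[OF pos_affine(1)] d[OF kl(1)] v[OF kl(1)] unfolding q_def by metis
    also have "\<dots> = q l" using eq by (auto simp: prod_eq_iff)
    finally have e: "fst (S l) (emb (W l)) = fst (S k) ?z" unfolding q_def using pos_eq by metis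
    note n = dart_nodes[of "U k" "W k" "A k"] dart_nodes[of "U l" "W l" "A l"]
    have z: "?z \<in> tri" using d[OF kl(1)] n(1,2) nodes_in_tri by (intro midpoint_in_tri) blast+
    have wl: "W l \<in> nodes" using d[OF kl(2)] n by blast
    obtain v1 where v1: "v1 \<in> nodes" "fst (S l) (emb (W l)) = fst (S k) (emb v1)"
      using compatible_node[OF level_compatible wl e z] d[OF kl(1)] d[OF kl(2)] by metis
    have "inj (fst (S k))" using affine_inj_level[of "S k" n] d[OF kl(1)] by (simp add: affine_inj_def)
    then have "?z = emb v1" using e v1(2) by (simp add: inj_eq)
    moreover have "emb (U k) \<noteq> emb (W k)" using d[OF kl(1)] n(3) by simp
    then have "?z \<in> open_segment (emb (U k)) (emb (W k))" by (rule midpoint_in_open_segment)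
    ultimately show False using node_not_in_open_edge[of "U k" "W k" "A k" v1] d[OF kl(1)] v1(1) by simp
  qed
  have q_inj: "k = l" if kl: "k \<in> {0..<8}" "l \<in> {0..<8}" "q k = q l" for k l
  proof -
    have "fst (S k) (emb (W k)) = fst (S l) (emb (W l))" using kl(3) unfolding q_def using pos_eq by metis
    then have "8 dvd (snd (S k) + A k) - (snd (S l) + A l)"
      using compatible_dart[OF level_compatible, of "S k" n "S l"] d[OF kl(1)] d[OF kl(2)] by metis
    then have "(snd (S k) + A k) mod 8 = (snd (S l) + A l) mod 8" by (simp only: mod_eq_dvd_iff)
    then show ?thesis using d[OF kl(1)] d[OF kl(2)] by metis
  qed
  show thesis
  proof
    show "inj_on (\<lambda>k. {v, v + c k *\<^sub>R (q k - v)}) {0..<8}"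
    proof (rule inj_onI)
      fix k l assume kl: "k \<in> {0..<8}" "l \<in> {0..<8}" "{v, v + c k *\<^sub>R (q k - v)} = {v, v + c l *\<^sub>R (q l - v)}"
      then have "v + c k *\<^sub>R (q k - v) = v + c l *\<^sub>R (q l - v)" unfolding doubleton_eq_iff by metis
      then have "c k *\<^sub>R (q k - v) = c l *\<^sub>R (q l - v)" by simp
      then have "q k = q l"
        using c[OF kl(1)] c[OF kl(2)] no_middle[OF kl(1,2)] no_middle[OF kl(2,1)] by auto
      then show "k = l" using q_inj kl by blast
    qed
    show "(\<lambda>k. {v, v + c k *\<^sub>R (q k - v)}) ` {0..<8} \<subseteq> corner_edges T" using c by blast
    show "v \<in> {v, v + c k *\<^sub>R (q k - v)}" for k by simp
  qed
qed

end

theorem proposition5p3: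
  fixes T :: "tile set"
  assumes "rational_pinwheel_tiling T"
  shows "chromatic_index (tiling_graph T) = 8"
proof (rule antisym)
  have "enat 8 \<in> {enat k | k. \<exists>c. proper_edge_colouring (tiling_graph T) c \<and> c ` snd (tiling_graph T) \<subseteq> {..<k}}"
    using eight_colouring[OF assms] by blast
  then show "chromatic_index (tiling_graph T) \<le> 8"
    unfolding chromatic_index_def by (intro Inf_lower) (simp add: numeral_eq_enat)
next
  obtain f n where "patch T f n 100" using patch_exists[OF assms] by blast
  then interpret patch T f n 100 .
  obtain v e where e: "inj_on e {0..<8::int}" "e ` {0..<8} \<subseteq> corner_edges T" "\<And>k. k \<in> {0..<8} \<Longrightarrow> v \<in> e k"
    by (rule degree_eight[OF order_refl]) blast
  show "8 \<le> chromatic_index (tiling_graph T)"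
    unfolding chromatic_index_def
  proof (rule Inf_greatest, clarify)
    fix k c assume c: "proper_edge_colouring (tiling_graph T) c" "c ` snd (tiling_graph T) \<subseteq> {..<k}"
    have sub: "e ` {0..<8} \<subseteq> snd (tiling_graph T)" using e(2) by (simp add: tiling_graph_def)
    have "inj_on c (e ` {0..<8})"
    proof (rule inj_onI, rule ccontr)
      fix x y assume xy: "x \<in> e ` {0..<8}" "y \<in> e ` {0..<8}" "c x = c y" "x \<noteq> y"
      then have "x \<inter> y \<noteq> {}" using e(3) by blast
      then show False using c(1) xy sub unfolding proper_edge_colouring_def by blast
    qed
    then have "inj_on (c \<circ> e) {0..<8}" using e(1) by (intro comp_inj_on)
    then have "card ((c \<circ> e) ` {0..<8}) = 8" by (simp only: card_image) simp
    moreover have "(c \<circ> e) ` {0..<8} \<subseteq> {..<k}" using c(2) sub by fastforce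
    then have "card ((c \<circ> e) ` {0..<8}) \<le> k" using card_mono[of "{..<k}"] by simp
    ultimately show "8 \<le> enat k" by (simp add: numeral_eq_enat)
  qed
qed

end
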